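(* Let $Y$ be a Banach space, $A,B\in\mathscr{B}(Y)$, $1<\alpha\le2$, $0<\beta\le1$, $\eta,\hat\eta\in Y$. Assume that the Cauchy problem $$\left({}^{C}D^{\alpha}_{0+}x\right)(t)-A\left({}^{C}D^{\beta}_{0+}x\right)(t)=Bx(t)+g(t),\quad t>0,\qquad x(0)=\eta,\quad x'(0)=\hat\eta,$$ has a unique continuous solution $x(t)$ on $[0,\infty)$. If $g$ is continuous and exponentially bounded on $[0,\infty)$ and ${}^{C}D^{\beta}_{0+}x$ is exponentially bounded on $[0,\infty)$, then $x$ and its Caputo derivative ${}^{C}D^{\alpha}_{0+}x$ are exponentially bounded on $[0,\infty)$ and, thus, their Laplace transforms exist.
   Context: $\mathscr{B}(Y)$ is the space of bounded linear operators on $Y$. For $n-1<\nu\le n$, $n\in\mathbb{N}$, the Caputo derivative is $({}^{C}D^{\nu}_{0+}x)(t)=\frac{1}{\Gamma(n-\nu)}\int_0^t(t-s)^{n-\nu-1}x^{(n)}(s)\,ds$ (Bochner integral), understood as $x^{(n)}(t)$ when $\nu=n$. A function $h:[0,\infty)\to Y$ is exponentially bounded if there are positive constants $L,\delta$ and a sufficiently large $T$ such that $\|h(t)\|\le L\exp(\delta t)$ for all $t\ge T$. *)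

theory Defs
  imports "HOL-Analysis.Analysis"
begin

(* The library's Bochner integral has_bochner_integral is restricted to second countable
   (separable) target spaces.  The definition below drops this restriction; Borel measurability
   is replaced by strong measurability, as it has to be for non-separable spaces. *)

definition strongly_measurable :: "'s measure \<Rightarrow> ('s \<Rightarrow> 'a::real_normed_vector) \<Rightarrow> bool" where
  "strongly_measurable M f \<longleftrightarrow>
     (\<exists>s::nat \<Rightarrow> 's \<Rightarrow> 'a. (\<forall>i. simple_function M (s i)) \<and> (AE x in M. (\<lambda>i. s i x) \<longlonglongrightarrow> f x))"

definition has_strong_bochner_integral ::
    "'s measure \<Rightarrow> ('s \<Rightarrow> 'a::real_normed_vector) \<Rightarrow> 'a \<Rightarrow> bool" where
  "has_strong_bochner_integral M f I \<longleftrightarrow>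
     strongly_measurable M f \<and>
     (\<exists>s::nat \<Rightarrow> 's \<Rightarrow> 'a.
        (\<forall>i. Bochner_Integration.simple_bochner_integrable M (s i)) \<and>
        (\<lambda>i. \<integral>\<^sup>+x. norm (f x - s i x) \<partial>M) \<longlonglongrightarrow> 0 \<and>
        (\<lambda>i. Bochner_Integration.simple_bochner_integral M (s i)) \<longlonglongrightarrow> I)"

lemma has_bochner_integral_imp_strong:
  fixes f :: "'s \<Rightarrow> 'a::{real_normed_vector, second_countable_topology}"
  assumes "has_bochner_integral M f I"
  shows "has_strong_bochner_integral M f I"
  using assms
proof cases
  case (1 s)
  obtain F where F: "\<And>i. simple_function M (F i)"
    "\<And>x. x \<in> space M \<Longrightarrow> (\<lambda>i. F i x) \<longlonglongrightarrow> f x"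
    using borel_measurable_implies_sequence_metric[OF 1(1), of 0] by blast
  have "strongly_measurable M f"
    unfolding strongly_measurable_def by (rule exI[of _ F]) (use F in auto)
  then show ?thesis
    unfolding has_strong_bochner_integral_def using 1 by blast
qed

(* Functions on [0,\<infinity>) are represented by functions on the reals of which only the values on
   {0..} matter: derivatives are taken within {0..}, so they are one-sided at 0 and ordinary
   derivatives at every t > 0. *)

fun nth_deriv :: "nat \<Rightarrow> (real \<Rightarrow> 'a::real_normed_vector) \<Rightarrow> real \<Rightarrow> 'a" where
  "nth_deriv 0 x = x"
| "nth_deriv (Suc n) x = (\<lambda>t. vector_derivative (nth_deriv n x) (at t within {0..}))"

(* For nu > 0, nat (ceiling nu) is the n with n - 1 < nu \<le> n.  Derivatives of order up to n are
   required at the points of (0,t] only: for non-integer nu the n-th derivative of a solution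
   is in general singular at 0. *)

definition has_caputo_derivative ::
    "real \<Rightarrow> (real \<Rightarrow> 'a::real_normed_vector) \<Rightarrow> real \<Rightarrow> 'a \<Rightarrow> bool" where
  "has_caputo_derivative \<nu> x t D \<longleftrightarrow>
     (let n = nat \<lceil>\<nu>\<rceil> in
        (\<forall>k<n. \<forall>s\<in>{0<..t}. nth_deriv k x differentiable (at s within {0..})) \<and>
        (if \<nu> = real n then D = nth_deriv n x t
         else \<exists>J. has_strong_bochner_integral (lebesgue_on {0..t})
                    (\<lambda>s. ((t - s) powr (real n - \<nu> - 1)) *\<^sub>R nth_deriv n x s) J \<and>
                  D = (1 / Gamma (real n - \<nu>)) *\<^sub>R J))"

definition caputo_differentiable ::
    "real \<Rightarrow> (real \<Rightarrow> 'a::real_normed_vector) \<Rightarrow> real \<Rightarrow> bool" where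
  "caputo_differentiable \<nu> x t \<longleftrightarrow> (\<exists>D. has_caputo_derivative \<nu> x t D)"

definition caputo_derivative ::
    "real \<Rightarrow> (real \<Rightarrow> 'a::real_normed_vector) \<Rightarrow> real \<Rightarrow> 'a" where
  "caputo_derivative \<nu> x t = (THE D. has_caputo_derivative \<nu> x t D)"

definition exponentially_bounded :: "(real \<Rightarrow> 'a::real_normed_vector) \<Rightarrow> bool" where
  "exponentially_bounded h \<longleftrightarrow>
     (\<exists>L>0. \<exists>\<delta>>0. \<exists>T\<ge>0. \<forall>t\<ge>T. norm (h t) \<le> L * exp (\<delta> * t))"

definition cauchy_solution ::
    "real \<Rightarrow> real \<Rightarrow> ('a::real_normed_vector \<Rightarrow>\<^sub>L 'a) \<Rightarrow> ('a \<Rightarrow>\<^sub>L 'a) \<Rightarrow> (real \<Rightarrow> 'a) \<Rightarrow> 'a \<Rightarrow> 'a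
      \<Rightarrow> (real \<Rightarrow> 'a) \<Rightarrow> bool" where
  "cauchy_solution \<alpha> \<beta> A B g \<eta> \<eta>' x \<longleftrightarrow>
     continuous_on {0..} x \<and>
     x 0 = \<eta> \<and> (x has_vector_derivative \<eta>') (at 0 within {0..}) \<and>
     (\<forall>t>0. caputo_differentiable \<alpha> x t \<and> caputo_differentiable \<beta> x t \<and>
        caputo_derivative \<alpha> x t - blinfun_apply A (caputo_derivative \<beta> x t)
          = blinfun_apply B (x t) + g t)"

(* The Laplace transform at a complex number z takes values in the complexification of 'a,
   modelled as 'a \<times> 'a (real part, imaginary part).  If 'a carries a complex structure J, the
   usual transform is the image of (u, v) under u + J v; for real z the second component is 0. *)

definition has_laplace_transform ::
    "(real \<Rightarrow> 'a::real_normed_vector) \<Rightarrow> complex \<Rightarrow> 'a \<times> 'a \<Rightarrow> bool" where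
  "has_laplace_transform f z F \<longleftrightarrow>
     has_strong_bochner_integral (lebesgue_on {0..})
       (\<lambda>t. (Re (exp (- z * complex_of_real t)) *\<^sub>R f t,
             Im (exp (- z * complex_of_real t)) *\<^sub>R f t)) F"

definition laplace_transform_exists :: "(real \<Rightarrow> 'a::real_normed_vector) \<Rightarrow> bool" where
  "laplace_transform_exists f \<longleftrightarrow>
     (\<exists>\<sigma>::real. \<forall>z. Re z > \<sigma> \<longrightarrow> (\<exists>F. has_laplace_transform f z F))"

end

theory Submission
  imports Defs
begin

text \<open>
  Only the Caputo derivative \<open>h\<close> of order \<open>\<beta>\<close> needs work. The equation reads \<open>h\<^sub>\<alpha> = A h + B x + g\<close>,
  where \<open>h\<^sub>\<alpha>\<close> is the derivative of order \<open>\<alpha>\<close>, so \<open>h\<^sub>\<alpha>\<close> inherits exponential growth, continuity on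
  \<open>(0,\<infinity>)\<close> and integrability near \<open>0\<close> from \<open>h\<close>, \<open>x\<close> and \<open>g\<close>. These three properties suffice for a
  Laplace transform (\<open>laplace_transform_exists_continuous\<close>). Two questions remain: why growth of \<open>h\<close>
  controls growth of \<open>x\<close>, and why \<open>h\<close> is continuous on \<open>(0,\<infinity>)\<close> and integrable near \<open>0\<close>.

  For \<open>\<beta> < 1\<close>, \<open>h\<close> is the fractional integral of order \<open>1 - \<beta>\<close> of \<open>x'\<close>. Integrating it once more, with
  order \<open>\<beta>\<close>, gives \<open>x(t) - x(0)\<close>, because the two power kernels convolve to a constant (a Beta
  integral). This Abel inversion bounds \<open>\<parallel>x(t) - x(0)\<parallel>\<close> by a weakly singular integral of \<open>\<parallel>h\<parallel>\<close>, which
  grows exponentially if \<open>h\<close> does. Since \<open>x'\<close> is itself differentiable on \<open>(0,\<infinity>)\<close> it is continuous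
  there, and it is integrable near \<open>0\<close>; hence \<open>h\<close> is locally Hoelder continuous on \<open>(0,\<infinity>)\<close>, and it is
  integrable near \<open>0\<close> by Tonelli's theorem.

  For \<open>\<beta> = 1\<close>, \<open>h\<close> is \<open>x'\<close>, and \<open>x\<close> is estimated by integrating once. It remains to see that \<open>x'\<close> is
  bounded near \<open>0\<close>. If \<open>\<alpha> < 2\<close>, existence of the derivative of order \<open>\<alpha>\<close> makes \<open>x''\<close> integrable near
  \<open>0\<close>. If \<open>\<alpha> = 2\<close>, the equation says that \<open>x' - A x\<close> has the derivative \<open>B x + g\<close>, which is bounded near
  \<open>0\<close>.

  The space may be non-separable. For \<open>\<beta> < 1\<close>, Fubini's theorem is therefore applied to scalar functions
  only: the vector to be estimated is tested against a linear functional of norm at most one that attains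
  its norm (\<open>norming_functional\<close>). Bochner integrals commute with such functionals, and the resulting
  bounds do not depend on the functional.
\<close>

section \<open>Norming functionals\<close>

definition sublinear :: "('a::real_vector \<Rightarrow> real) \<Rightarrow> bool" where
  "sublinear p \<longleftrightarrow> (\<forall>x y. p (x + y) \<le> p x + p y) \<and> (\<forall>c x. 0 \<le> c \<longrightarrow> p (c *\<^sub>R x) = c * p x)"

lemma sublinearD:
  assumes "sublinear p"
  shows sublinear_add: "p (x + y) \<le> p x + p y"
    and sublinear_scaleR: "0 \<le> c \<Longrightarrow> p (c *\<^sub>R x) = c * p x"
    and sublinear_zero: "p 0 = 0"
    and sublinear_minus: "- p (- x) \<le> p x"
proof -
  show add: "p (x + y) \<le> p x + p y" and "0 \<le> c \<Longrightarrow> p (c *\<^sub>R x) = c * p x" for x y c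
    using assms by (auto simp: sublinear_def)
  from this(2)[of 0 0] show "p 0 = 0" by simp
  with add[of x "- x"] show "- p (- x) \<le> p x" by simp
qed

text \<open>
  The largest sublinear functional below \<open>p\<close> whose value at \<open>- v\<close> is at most \<open>- p v\<close>. It serves two
  purposes: it starts the Hahn-Banach argument at a functional that already norms \<open>v\<close>, and it
  shows that a sublinear functional that is not odd is not minimal.
\<close>

definition sublinear_shrink :: "('a::real_vector \<Rightarrow> real) \<Rightarrow> 'a \<Rightarrow> 'a \<Rightarrow> real" where
  "sublinear_shrink p v x = (INF t\<in>{0..}. p (x + t *\<^sub>R v) - t * p v)"

lemma sublinear_shrink:
  assumes p: "sublinear p"
  shows sublinear_sublinear_shrink: "sublinear (sublinear_shrink p v)"
    and sublinear_shrink_le: "sublinear_shrink p v x \<le> p x"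
    and sublinear_shrink_minus: "sublinear_shrink p v (- v) \<le> - p v"
proof -
  have bdd: "bdd_below ((\<lambda>t. p (x + t *\<^sub>R v) - t * p v) ` {0..})" for x
  proof (rule bdd_belowI2)
    fix t :: real assume t: "t \<in> {0..}"
    have "p (t *\<^sub>R v) \<le> p (x + t *\<^sub>R v) + p (- x)"
      using sublinear_add[OF p, of "x + t *\<^sub>R v" "- x"] by simp
    then show "- p (- x) \<le> p (x + t *\<^sub>R v) - t * p v"
      using t by (simp add: sublinear_scaleR[OF p])
  qed
  have le: "sublinear_shrink p v x \<le> p (x + t *\<^sub>R v) - t * p v" if "0 \<le> t" for x t
    unfolding sublinear_shrink_def using that by (intro cINF_lower bdd) auto
  have greatest: "c \<le> sublinear_shrink p v x"
    if "\<And>t. 0 \<le> t \<Longrightarrow> c \<le> p (x + t *\<^sub>R v) - t * p v" for x c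
    unfolding sublinear_shrink_def using that by (intro cINF_greatest) auto
  show le_p: "sublinear_shrink p v x \<le> p x" for x
    using le[of 0 x] by simp
  show "sublinear_shrink p v (- v) \<le> - p v"
    using le[of 1 "- v"] by (simp add: sublinear_zero[OF p])
  have add: "sublinear_shrink p v (x + y) \<le> sublinear_shrink p v x + sublinear_shrink p v y" for x y
  proof -
    \<comment> \<open>The two infima are taken one after the other, so that each step bounds a fixed number from above.\<close>
    have "sublinear_shrink p v (x + y) - (p (y + s *\<^sub>R v) - s * p v) \<le> p (x + t *\<^sub>R v) - t * p v"
      if "0 \<le> s" "0 \<le> t" for s t
      using le[of "t + s" "x + y"] sublinear_add[OF p, of "x + t *\<^sub>R v" "y + s *\<^sub>R v"] that
      by (simp add: algebra_simps)
    then have "sublinear_shrink p v (x + y) - (p (y + s *\<^sub>R v) - s * p v) \<le> sublinear_shrink p v x"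
      if "0 \<le> s" for s
      using that by (intro greatest)
    then have "sublinear_shrink p v (x + y) - sublinear_shrink p v x \<le> sublinear_shrink p v y"
      by (intro greatest) (simp add: algebra_simps)
    then show ?thesis by simp
  qed
  have scale_le: "sublinear_shrink p v (c *\<^sub>R x) \<le> c * sublinear_shrink p v x" if "0 < c" for c x
  proof -
    have "sublinear_shrink p v (c *\<^sub>R x) / c \<le> sublinear_shrink p v x"
    proof (rule greatest)
      fix t :: real assume "0 \<le> t"
      then have "sublinear_shrink p v (c *\<^sub>R x) \<le> p (c *\<^sub>R (x + t *\<^sub>R v)) - (c * t) * p v"
        using le[of "c * t" "c *\<^sub>R x"] that by (simp add: scaleR_add_right)
      also have "\<dots> = (p (x + t *\<^sub>R v) - t * p v) * c"
        using sublinear_scaleR[OF p, of c "x + t *\<^sub>R v"] that by (simp add: algebra_simps)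
      finally show "sublinear_shrink p v (c *\<^sub>R x) / c \<le> p (x + t *\<^sub>R v) - t * p v"
        using that by (simp add: divide_simps)
    qed
    then show ?thesis using that by (simp add: divide_simps mult.commute)
  qed
  have "sublinear_shrink p v 0 = 0"
  proof (rule antisym)
    show "sublinear_shrink p v 0 \<le> 0" using le_p[of 0] by (simp add: sublinear_zero[OF p])
    show "0 \<le> sublinear_shrink p v 0"
      by (rule greatest) (simp add: sublinear_scaleR[OF p])
  qed
  then have "sublinear_shrink p v (c *\<^sub>R x) = c * sublinear_shrink p v x" if "0 \<le> c" for c x
    using that scale_le[of c x] scale_le[of "1/c" "c *\<^sub>R x"]
    by (cases "c = 0") (auto intro!: antisym simp: field_simps)
  with add show "sublinear (sublinear_shrink p v)"
    by (auto simp: sublinear_def)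
qed

text \<open>
  If \<open>p\<close> is minimal, shrinking it in the direction \<open>v\<close> changes nothing, so \<open>p (- v) \<le> - p v\<close>. An odd
  sublinear functional is linear.
\<close>

lemma minimal_sublinear_linear:
  assumes p: "sublinear p" and minimal: "\<And>q. sublinear q \<Longrightarrow> q \<le> p \<Longrightarrow> q = p"
  shows "linear p"
proof -
  have odd: "p (- v) = - p v" for v
  proof (rule antisym)
    have "sublinear_shrink p v = p"
      by (intro minimal sublinear_sublinear_shrink p) (simp add: le_fun_def sublinear_shrink_le[OF p])
    then show "p (- v) \<le> - p v"
      using sublinear_shrink_minus[OF p, of v] by simp
    show "- p v \<le> p (- v)"
      using sublinear_minus[OF p, of v] by simp
  qed
  have add: "p (x + y) = p x + p y" for x y
    using sublinear_add[OF p, of x y] sublinear_add[OF p, of "- x" "- y"] odd[of "x + y"]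
    by (simp add: odd)
  have "p (c *\<^sub>R x) = c * p x" for c x
  proof (cases "0 \<le> c")
    case False
    then have "p ((- c) *\<^sub>R (- x)) = (- c) * p (- x)"
      by (intro sublinear_scaleR[OF p]) simp
    then show ?thesis by (simp add: odd)
  qed (simp add: sublinear_scaleR[OF p])
  with add show "linear p"
    by (intro linearI) auto
qed

lemma sublinear_le_norm_bounds:
  fixes q :: "'a::real_normed_vector \<Rightarrow> real"
  assumes "sublinear q" "q \<le> norm"
  shows "\<bar>q x\<bar> \<le> norm x"
proof -
  have "q x \<le> norm x" "q (- x) \<le> norm (- x)"
    using assms(2) unfolding le_fun_def by blast+
  with sublinear_minus[OF assms(1), of x] show ?thesis by simp
qed

text \<open>
  The Hahn-Banach theorem in the form needed here. Zorn's lemma gives a minimal sublinear functional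
  below the norm shrunk in the direction \<open>v\<close>; minimality makes it linear, and the shrinking forces its
  value at \<open>v\<close> up to the norm of \<open>v\<close>.
\<close>

lemma norming_functional:
  fixes v :: "'a::real_normed_vector"
  obtains \<phi> :: "'a \<Rightarrow> real" where "bounded_linear \<phi>" "\<And>x. \<bar>\<phi> x\<bar> \<le> norm x" "\<phi> v = norm v"
proof -
  define q0 where "q0 = sublinear_shrink norm v"
  have norm_sub: "sublinear (norm :: 'a \<Rightarrow> real)"
    by (auto simp: sublinear_def norm_triangle_ineq)
  have q0: "sublinear q0" "q0 \<le> norm" "q0 (- v) \<le> - norm v"
    using sublinear_shrink[OF norm_sub, of v] by (auto simp: q0_def le_fun_def)
  define A where "A = {q. sublinear q \<and> q \<le> q0}"
  have "\<exists>m\<in>A. \<forall>q\<in>A. q \<le> m \<longrightarrow> q = m"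
  proof (rule predicate_Zorn)
    show "partial_order_on A (relation_of (\<lambda>x y. y \<le> x) A)"
      by (auto simp: partial_order_on_def preorder_on_def refl_on_def trans_def antisym_def relation_of_def)
  next
    fix C assume "C \<in> Chains (relation_of (\<lambda>x y. y \<le> x) A)"
    then have CA: "C \<subseteq> A" and chain: "\<And>q r. q \<in> C \<Longrightarrow> r \<in> C \<Longrightarrow> q \<le> r \<or> r \<le> q"
      by (auto simp: Chains_def relation_of_def)
    show "\<exists>u\<in>A. \<forall>a\<in>C. u \<le> a"
    proof (cases "C = {}")
      case True
      with q0 show ?thesis by (auto simp: A_def)
    next
      case False
      \<comment> \<open>The pointwise infimum of a chain is again sublinear, since of any two members one lies below the other.\<close>
      define u where "u x = (INF q\<in>C. q x)" for x
      have C: "sublinear q" "q \<le> q0" if "q \<in> C" for q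
        using that CA by (auto simp: A_def)
      have bound: "\<bar>q x\<bar> \<le> norm x" if "q \<in> C" for q x
        using C[OF that] q0 by (intro sublinear_le_norm_bounds) auto
      have bdd: "bdd_below ((\<lambda>q. q x) ` C)" for x
        by (rule bdd_belowI2[of _ "- norm x"]) (use bound in \<open>smt (verit)\<close>)
      have le: "u x \<le> q x" if "q \<in> C" for q x
        unfolding u_def using that by (intro cINF_lower bdd)
      have greatest: "c \<le> u x" if "\<And>q. q \<in> C \<Longrightarrow> c \<le> q x" for c x
        unfolding u_def using that False by (intro cINF_greatest)
      have add: "u (x + y) \<le> u x + u y" for x y
      proof -
        have "u (x + y) \<le> q x + r y" if qr: "q \<in> C" "r \<in> C" for q r
        proof -
          obtain s where s: "s \<in> C" "s \<le> q" "s \<le> r"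
            using chain[OF qr] qr by auto
          then show ?thesis
            using le[OF s(1), of "x + y"] sublinear_add[OF C(1)[OF s(1)], of x y]
            by (smt (verit) le_fun_def)
        qed
        then have "u (x + y) - q x \<le> u y" if "q \<in> C" for q
          using that by (intro greatest) (metis add.commute diff_le_eq)
        then have "u (x + y) - u y \<le> u x"
          by (intro greatest) (simp add: algebra_simps)
        then show ?thesis by simp
      qed
      have scale: "u (c *\<^sub>R x) = c * u x" if "0 \<le> c" for c x
      proof -
        have *: "q (c *\<^sub>R x) = c * q x" if "q \<in> C" for q
          using C(1)[OF that] \<open>0 \<le> c\<close> by (rule sublinear_scaleR)
        show ?thesis
        proof (cases "c = 0")
          case True
          have "u 0 = (INF q\<in>C. 0)"
            unfolding u_def using C by (intro INF_cong) (auto simp: sublinear_zero)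
          with True False show ?thesis by simp
        next
          case pos: False
          have "u (c *\<^sub>R x) \<le> c * q x" if "q \<in> C" for q
            using le[OF that, of "c *\<^sub>R x"] *[OF that] by simp
          then have "u (c *\<^sub>R x) / c \<le> u x"
            using pos \<open>0 \<le> c\<close> by (intro greatest) (simp add: field_simps)
          moreover have "c * u x \<le> u (c *\<^sub>R x)"
            using \<open>0 \<le> c\<close> by (intro greatest) (simp add: * le mult_left_mono)
          ultimately show ?thesis
            using pos \<open>0 \<le> c\<close> by (simp add: field_simps)
        qed
      qed
      obtain q where "q \<in> C" using False by auto
      then have "u \<le> q0"
        using le C(2) by (meson le_funI le_fun_def order_trans)
      with add scale have "u \<in> A" by (auto simp: A_def sublinear_def)
      with le show ?thesis by (auto simp: le_fun_def)
    qed
  qed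
  then obtain \<phi> where \<phi>: "sublinear \<phi>" "\<phi> \<le> q0" and min: "\<And>q. sublinear q \<Longrightarrow> q \<le> \<phi> \<Longrightarrow> q = \<phi>"
    unfolding A_def by (smt (verit) mem_Collect_eq order_trans)
  have lin: "linear \<phi>" using \<phi>(1) min by (rule minimal_sublinear_linear)
  have bound: "\<bar>\<phi> x\<bar> \<le> norm x" for x
    using \<phi> q0 by (intro sublinear_le_norm_bounds) auto
  show ?thesis
  proof
    show "bounded_linear \<phi>"
      using lin bound by (auto intro!: bounded_linear_intro[of _ 1] simp: linear_add linear_scale)
    have "\<phi> (- v) \<le> - norm v" using \<phi>(2) q0(3) by (meson le_fun_def order_trans)
    then show "\<phi> v = norm v"
      using bound[of v] by (simp add: linear_neg[OF lin])
  qed (rule bound)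
qed

section \<open>Bochner integrals with values in a Banach space\<close>

text \<open>
  Lebesgue measure is complete, so an almost everywhere limit of measurable real functions is measurable.
  The relevant cases are functionals and the distance to a fixed vector.
\<close>

lemma strongly_measurable_continuous_real:
  fixes f :: "real \<Rightarrow> 'a::real_normed_vector" and \<psi> :: "'a \<Rightarrow> real"
  assumes S: "S \<in> sets lebesgue" and f: "strongly_measurable (lebesgue_on S) f"
    and \<psi>: "continuous_on UNIV \<psi>"
  shows "(\<lambda>x. \<psi> (f x)) \<in> borel_measurable (lebesgue_on S)"
proof -
  obtain s where s: "\<And>i. simple_function (lebesgue_on S) (s i)"
    and lim: "AE x in lebesgue_on S. (\<lambda>i. s i x) \<longlonglongrightarrow> f x"
    using f by (auto simp: strongly_measurable_def)
  have S': "S \<inter> space lebesgue \<in> sets lebesgue" using S by simp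
  define g where "g i x = indicator S x *\<^sub>R \<psi> (s i x)" for i x
  have "(\<lambda>x. \<psi> (s i x)) \<in> borel_measurable (lebesgue_on S)" for i
    by (rule borel_measurable_simple_function[OF simple_function_compose1[OF s]])
  then have "g i \<in> borel_measurable lebesgue" for i
    unfolding g_def by (rule borel_measurable_restrict_space_iff[OF S', THEN iffD1])
  then have L: "(\<lambda>x. lim (\<lambda>i. g i x)) \<in> borel_measurable lebesgue"
    by (rule borel_measurable_lim_metric)
  have "AE x in lebesgue. x \<in> S \<longrightarrow> (\<lambda>i. s i x) \<longlonglongrightarrow> f x"
    using lim AE_restrict_space_iff[OF S'] by auto
  then have "AE x in lebesgue. lim (\<lambda>i. g i x) = indicator S x *\<^sub>R \<psi> (f x)"
  proof eventually_elim
    case (elim x)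
    have "(\<lambda>i. g i x) \<longlonglongrightarrow> indicator S x *\<^sub>R \<psi> (f x)"
    proof (cases "x \<in> S")
      case True
      then have "(\<lambda>i. \<psi> (s i x)) \<longlonglongrightarrow> \<psi> (f x)"
        using elim \<psi> by (intro continuous_on_tendsto_compose[OF \<psi>]) auto
      then show ?thesis unfolding g_def by (intro tendsto_intros)
    qed (simp add: g_def)
    then show ?case by (rule limI)
  qed
  with L have "(\<lambda>x. indicator S x *\<^sub>R \<psi> (f x)) \<in> borel_measurable lebesgue"
    by (rule borel_measurable_AE)
  then show ?thesis
    using borel_measurable_restrict_space_iff[OF S'] by blast
qed

text \<open>
  On a non-separable space the difference of two Borel measurable functions need not be Borel measurable. As
  a simple function takes only finitely many values, the difference can be treated one value at a time.
\<close>

lemma borel_measurable_norm_diff_simple: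
  fixes f :: "'s \<Rightarrow> 'a::real_normed_vector"
  assumes f: "\<And>c. (\<lambda>x. norm (f x - c)) \<in> borel_measurable M" and s: "simple_function M s"
  shows "(\<lambda>x. norm (f x - s x)) \<in> borel_measurable M"
proof (rule measurable_compose_countable'[where I = "s ` space M" and f = "\<lambda>c x. norm (f x - c)"])
  show "countable (s ` space M)"
    using s by (simp add: simple_function_def countable_finite)
  show "s \<in> measurable M (count_space (s ` space M))"
    using s by (auto simp: simple_function_def measurable_def) (metis s simple_functionD(2))
qed (rule f)

lemma simple_bochner_integrable_nn_finite:
  assumes "Bochner_Integration.simple_bochner_integrable M s"
  shows "(\<integral>\<^sup>+x. norm (s x) \<partial>M) < \<infinity>"
proof -
  have "Bochner_Integration.simple_bochner_integrable M (\<lambda>x. norm (s x))"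
    using simple_bochner_integrable_compose2[OF _ assms assms, of "\<lambda>x y. norm x"] by simp
  from simple_bochner_integral_eq_nn_integral[OF this] show ?thesis
    by (metis ennreal_less_top infinity_ennreal_def norm_ge_zero)
qed

lemma nn_integral_norm_le_add:
  fixes f :: "'s \<Rightarrow> 'a::real_normed_vector"
  assumes "(\<lambda>x. norm (f x - g x)) \<in> borel_measurable M" "(\<lambda>x. norm (f x - h x)) \<in> borel_measurable M"
  shows "(\<integral>\<^sup>+x. norm (g x - h x) \<partial>M) \<le> (\<integral>\<^sup>+x. norm (f x - g x) \<partial>M) + (\<integral>\<^sup>+x. norm (f x - h x) \<partial>M)"
proof -
  have "norm (g x - h x) \<le> norm (f x - g x) + norm (f x - h x)" for x
    by (metis dual_order.refl norm_diff_triangle_le norm_minus_commute)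
  then have "(\<integral>\<^sup>+x. norm (g x - h x) \<partial>M) \<le> (\<integral>\<^sup>+x. ennreal (norm (f x - g x)) + ennreal (norm (f x - h x)) \<partial>M)"
    by (intro nn_integral_mono) (simp add: ennreal_plus[symmetric] ennreal_leI del: ennreal_plus)
  also have "\<dots> = (\<integral>\<^sup>+x. norm (f x - g x) \<partial>M) + (\<integral>\<^sup>+x. norm (f x - h x) \<partial>M)"
    using assms by (intro nn_integral_add) auto
  finally show ?thesis .
qed

lemma has_strong_bochner_integral_nn_finite:
  fixes f :: "real \<Rightarrow> 'a::real_normed_vector"
  assumes S: "S \<in> sets lebesgue" and f: "has_strong_bochner_integral (lebesgue_on S) f I"
  shows "(\<integral>\<^sup>+x. norm (f x) \<partial>lebesgue_on S) < \<infinity>"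
proof -
  let ?M = "lebesgue_on S"
  obtain s where s: "\<And>i. Bochner_Integration.simple_bochner_integrable ?M (s i)"
    and lim: "(\<lambda>i. \<integral>\<^sup>+x. norm (f x - s i x) \<partial>?M) \<longlonglongrightarrow> 0"
    and sm: "strongly_measurable ?M f"
    using f by (auto simp: has_strong_bochner_integral_def)
  from lim have "eventually (\<lambda>i. (\<integral>\<^sup>+x. norm (f x - s i x) \<partial>?M) < 1) sequentially"
    by (rule order_tendstoD) simp
  then obtain i where i: "(\<integral>\<^sup>+x. norm (f x - s i x) \<partial>?M) < 1"
    by (auto simp: eventually_sequentially)
  have meas: "(\<lambda>x. norm (f x - c)) \<in> borel_measurable ?M" for c
    by (rule strongly_measurable_continuous_real[OF S sm]) (intro continuous_intros)
  have simp_i: "simple_function ?M (s i)"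
    using s[of i] by (auto elim: simple_bochner_integrable.cases)
  have ms: "(\<lambda>x. norm (s i x)) \<in> borel_measurable ?M"
    by (rule borel_measurable_simple_function[OF simple_function_compose1[OF simp_i]])
  have md: "(\<lambda>x. norm (f x - s i x)) \<in> borel_measurable ?M"
    by (rule borel_measurable_norm_diff_simple[OF meas simp_i])
  have "(\<integral>\<^sup>+x. norm (f x - 0) \<partial>?M) \<le> (\<integral>\<^sup>+x. norm (s i x - f x) \<partial>?M) + (\<integral>\<^sup>+x. norm (s i x - 0) \<partial>?M)"
    using ms md by (intro nn_integral_norm_le_add) (simp_all add: norm_minus_commute)
  also have "\<dots> < \<infinity>"
    using i simple_bochner_integrable_nn_finite[OF s[of i]]
    by (auto simp: norm_minus_commute less_top[symmetric] top_unique)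
  finally show ?thesis by simp
qed

text \<open>
  Functionals of norm at most one map the approximating simple functions to approximating simple functions
  without increasing the error.
\<close>

lemma has_strong_bochner_integral_functional:
  fixes f :: "real \<Rightarrow> 'a::real_normed_vector" and \<phi> :: "'a \<Rightarrow> real"
  assumes S: "S \<in> sets lebesgue" and f: "has_strong_bochner_integral (lebesgue_on S) f I"
    and \<phi>: "bounded_linear \<phi>" and bound: "\<And>x. \<bar>\<phi> x\<bar> \<le> norm x"
  shows "has_bochner_integral (lebesgue_on S) (\<lambda>x. \<phi> (f x)) (\<phi> I)"
proof -
  let ?M = "lebesgue_on S"
  interpret \<phi>: bounded_linear \<phi> by fact
  obtain s where s: "\<And>i. Bochner_Integration.simple_bochner_integrable ?M (s i)"
    and lim: "(\<lambda>i. \<integral>\<^sup>+x. norm (f x - s i x) \<partial>?M) \<longlonglongrightarrow> 0"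
    and I: "(\<lambda>i. Bochner_Integration.simple_bochner_integral ?M (s i)) \<longlonglongrightarrow> I"
    and sm: "strongly_measurable ?M f"
    using f by (auto simp: has_strong_bochner_integral_def)
  show ?thesis
  proof (rule has_bochner_integral.intros[where s = "\<lambda>i x. \<phi> (s i x)"])
    show "(\<lambda>x. \<phi> (f x)) \<in> borel_measurable ?M"
      by (rule strongly_measurable_continuous_real[OF S sm]) (intro \<phi>.continuous_on continuous_intros)
    show "Bochner_Integration.simple_bochner_integrable ?M (\<lambda>x. \<phi> (s i x))" for i
      using simple_bochner_integrable_compose2[OF _ s[of i] s[of i], of "\<lambda>x y. \<phi> x"] by (simp add: \<phi>.zero)
    show "(\<lambda>i. \<integral>\<^sup>+x. norm (\<phi> (f x) - \<phi> (s i x)) \<partial>?M) \<longlonglongrightarrow> 0"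
    proof (rule tendsto_sandwich[OF _ _ tendsto_const lim])
      show "\<forall>\<^sub>F i in sequentially. (\<integral>\<^sup>+x. norm (\<phi> (f x) - \<phi> (s i x)) \<partial>?M) \<le> (\<integral>\<^sup>+x. norm (f x - s i x) \<partial>?M)"
        using bound by (intro always_eventually allI nn_integral_mono) (simp add: \<phi>.diff[symmetric] ennreal_leI)
    qed simp
    have "(\<lambda>i. \<phi> (Bochner_Integration.simple_bochner_integral ?M (s i))) \<longlonglongrightarrow> \<phi> I"
      by (intro \<phi>.tendsto I)
    then show "(\<lambda>i. Bochner_Integration.simple_bochner_integral ?M (\<lambda>x. \<phi> (s i x))) \<longlonglongrightarrow> \<phi> I"
      by (simp add: simple_bochner_integral_linear[OF \<phi>.linear s])
  qed
qed

lemma has_strong_bochner_integral_unique: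
  fixes f :: "real \<Rightarrow> 'a::real_normed_vector"
  assumes S: "S \<in> sets lebesgue" and "has_strong_bochner_integral (lebesgue_on S) f I"
    "has_strong_bochner_integral (lebesgue_on S) f J"
  shows "I = J"
proof -
  obtain \<phi> :: "'a \<Rightarrow> real" where \<phi>: "bounded_linear \<phi>" "\<And>x. \<bar>\<phi> x\<bar> \<le> norm x" "\<phi> (I - J) = norm (I - J)"
    using norming_functional[of "I - J"] by blast
  have "\<phi> I = \<phi> J"
    using has_bochner_integral_eq[OF has_strong_bochner_integral_functional[OF assms(1,2) \<phi>(1,2)]
      has_strong_bochner_integral_functional[OF assms(1,3) \<phi>(1,2)]] by simp
  with \<phi>(3) show ?thesis
    by (simp add: linear_diff[OF bounded_linear.linear[OF \<phi>(1)]])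
qed

text \<open>
  Two simple approximations differ in the mean by at most the sum of their errors, so their integrals
  form a Cauchy sequence; completeness provides the value of the integral.
\<close>

lemma has_strong_bochner_integral_approx:
  fixes f :: "'s \<Rightarrow> 'a::banach"
  assumes s: "\<And>i. Bochner_Integration.simple_bochner_integrable M (s i)"
    and meas: "\<And>i. (\<lambda>x. norm (f x - s i x)) \<in> borel_measurable M"
    and ae: "AE x in M. (\<lambda>i. s i x) \<longlonglongrightarrow> f x"
    and lim: "(\<lambda>i. \<integral>\<^sup>+x. norm (f x - s i x) \<partial>M) \<longlonglongrightarrow> 0"
  shows "\<exists>I. has_strong_bochner_integral M f I"
proof -
  let ?I = "\<lambda>i. Bochner_Integration.simple_bochner_integral M (s i)"
  let ?d = "\<lambda>i. \<integral>\<^sup>+x. norm (f x - s i x) \<partial>M"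
  have bound: "ennreal (norm (?I i - ?I j)) \<le> ?d i + ?d j" for i j
  proof -
    have sd: "Bochner_Integration.simple_bochner_integrable M (\<lambda>x. s i x - s j x)"
      by (rule simple_bochner_integrable_compose2[OF _ s s]) simp
    have "Bochner_Integration.simple_bochner_integrable M (\<lambda>x. norm (s i x - s j x))"
      using simple_bochner_integrable_compose2[OF _ sd sd, of "\<lambda>x y. norm x"] by simp
    note eq = simple_bochner_integral_eq_nn_integral[OF this]
    have "ennreal (norm (?I i - ?I j)) \<le> (\<integral>\<^sup>+x. norm (s i x - s j x) \<partial>M)"
      using simple_bochner_integral_norm_bound[OF sd] s
      by (simp add: eq[symmetric] simple_bochner_integral_diff ennreal_leI)
    also have "\<dots> \<le> ?d i + ?d j"
      by (rule nn_integral_norm_le_add[OF meas meas])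
    finally show ?thesis .
  qed
  have "Cauchy ?I"
  proof (rule metric_CauchyI)
    fix e :: real assume e: "0 < e"
    have "eventually (\<lambda>i. ?d i < ennreal (e/2)) sequentially"
      using lim e by (intro order_tendstoD) auto
    then obtain N where N: "\<And>i. N \<le> i \<Longrightarrow> ?d i < ennreal (e/2)"
      by (auto simp: eventually_sequentially)
    have "dist (?I i) (?I j) < e" if "N \<le> i" "N \<le> j" for i j
    proof -
      have "ennreal (norm (?I i - ?I j)) < ennreal (e/2) + ennreal (e/2)"
        using bound[of i j] add_strict_mono[OF N[OF that(1)] N[OF that(2)]] by (rule le_less_trans)
      also have "\<dots> = ennreal e" using e by (simp add: ennreal_plus[symmetric] del: ennreal_plus)
      finally show ?thesis using e by (simp add: dist_norm ennreal_less_iff)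
    qed
    then show "\<exists>N. \<forall>i\<ge>N. \<forall>j\<ge>N. dist (?I i) (?I j) < e" by blast
  qed
  then obtain I where "?I \<longlonglongrightarrow> I"
    using Cauchy_convergent_iff convergent_def by blast
  moreover have "strongly_measurable M f"
    using s ae unfolding strongly_measurable_def
    by (blast elim: simple_bochner_integrable.cases)
  ultimately show ?thesis
    using s lim unfolding has_strong_bochner_integral_def by blast
qed

text \<open>
  A function that is continuous on \<open>(0,\<infinity>)\<close> is sampled on finer and finer grids. A sample is replaced by
  \<open>0\<close> at late times, and at points where it is further from the function than \<open>0\<close> is; then the error never exceeds the norm
  of the function, and dominated convergence applies.
\<close>

lemma has_strong_bochner_integral_continuous:
  fixes f :: "real \<Rightarrow> 'a::banach"
  assumes cont: "continuous_on {0<..} f" and fin: "(\<integral>\<^sup>+x. norm (f x) \<partial>lebesgue_on {0..}) < \<infinity>"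
  shows "\<exists>I. has_strong_bochner_integral (lebesgue_on {0..}) f I"
proof -
  let ?M = "lebesgue_on {0::real..}"
  have meas[measurable]: "(\<lambda>t. norm (f t - c)) \<in> borel_measurable ?M" for c
  proof -
    have "(\<lambda>t. indicator {0<..} t *\<^sub>R norm (f t - c) + indicator {0} t * norm (f 0 - c)) \<in> borel_measurable borel"
      by (intro borel_measurable_add borel_measurable_continuous_on_indicator continuous_intros cont) auto
    then have "(\<lambda>t. indicator {0<..} t *\<^sub>R norm (f t - c) + indicator {0} t * norm (f 0 - c)) \<in> borel_measurable ?M"
      by (intro measurable_restrict_space1 measurable_completion) auto
    then show ?thesis
      by (rule measurable_cong[THEN iffD1, rotated]) (auto split: split_indicator)
  qed
  have measn[measurable]: "(\<lambda>t. norm (f t)) \<in> borel_measurable ?M"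
    using meas[of 0] by simp
  \<comment> \<open>Rounding up keeps the grid point in the domain of continuity, and maps 0 to itself.\<close>
  define q where "q i t = real_of_int \<lceil>real (Suc i) * t\<rceil> / real (Suc i)" for i :: nat and t :: real
  define P where "P i t \<longleftrightarrow> t \<le> real i \<and> norm (f t - f (q i t)) \<le> norm (f t)" for i t
  define s where "s i t = (if P i t then f (q i t) else 0)" for i t
  have simple: "simple_function ?M (s i)" for i
    unfolding simple_function_def
  proof (intro conjI ballI)
    have "s i t \<in> insert 0 ((\<lambda>k. f (real_of_int k / real (Suc i))) ` {0..\<lceil>real (Suc i) * real i\<rceil>})"
      if "0 \<le> t" for t
    proof (cases "P i t")
      case True
      then have "real (Suc i) * t \<le> real (Suc i) * real i"
        by (intro mult_left_mono) (auto simp: P_def)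
      then have "\<lceil>real (Suc i) * t\<rceil> \<in> {0..\<lceil>real (Suc i) * real i\<rceil>}"
        using that by (auto intro: ceiling_mono order_less_le_trans[of "-1" 0])
      then show ?thesis using True by (auto simp: s_def q_def simp del: of_nat_Suc)
    qed (simp add: s_def)
    then have "s i ` space ?M \<subseteq> insert 0 ((\<lambda>k. f (real_of_int k / real (Suc i))) ` {0..\<lceil>real (Suc i) * real i\<rceil>})"
      by auto
    then show "finite (s i ` space ?M)"
      by (rule finite_subset) auto
    have id: "(\<lambda>t. t) \<in> borel_measurable ?M"
      by (intro measurable_restrict_space1 measurable_completion) auto
    define h where "h k t = (if t \<le> real i \<and> norm (f t - f (real_of_int k / real (Suc i))) \<le> norm (f t)
        then f (real_of_int k / real (Suc i)) else 0)" for k :: int and t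
    have h: "h k \<in> measurable ?M (count_space UNIV)" for k
    proof -
      note [measurable] = id
      have "{t \<in> space ?M. t \<le> real i \<and> norm (f t - f (real_of_int k / real (Suc i))) \<le> norm (f t)} \<in> sets ?M"
        by measurable
      then show ?thesis
        unfolding h_def by (intro measurable_If measurable_const) simp_all
    qed
    have ceil: "(\<lambda>t. \<lceil>real (Suc i) * t\<rceil>) \<in> measurable ?M (count_space UNIV)"
      using id by measurable
    have "(\<lambda>t. h \<lceil>real (Suc i) * t\<rceil> t) \<in> measurable ?M (count_space UNIV)"
      using h ceil by (rule measurable_compose_countable[where f = h])
    then have "s i \<in> measurable ?M (count_space UNIV)"
      unfolding s_def P_def q_def h_def by simp
    then show "s i -` {y} \<inter> space ?M \<in> sets ?M" for y
      by (rule measurable_sets) auto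
  qed
  have le: "norm (f t - s i t) \<le> norm (f t)" for i t
    by (simp add: s_def P_def)
  have le2: "norm (s i t) \<le> 2 * norm (f t)" for i t
    using le[of t i] norm_triangle_ineq2[of "s i t" "f t"] by (simp add: norm_minus_commute)
  have measd: "(\<lambda>t. norm (f t - s i t)) \<in> borel_measurable ?M" for i
    by (rule borel_measurable_norm_diff_simple[OF meas simple])
  have sbi: "Bochner_Integration.simple_bochner_integrable ?M (s i)" for i
  proof (rule simple_bochner_integrableI_bounded[OF simple])
    have "(\<integral>\<^sup>+t. norm (s i t) \<partial>?M) \<le> (\<integral>\<^sup>+t. 2 * ennreal (norm (f t)) \<partial>?M)"
      using le2 by (intro nn_integral_mono) (metis ennreal_leI ennreal_mult ennreal_numeral norm_ge_zero zero_le_numeral)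
    also have "\<dots> = 2 * (\<integral>\<^sup>+t. norm (f t) \<partial>?M)" by (intro nn_integral_cmult) auto
    also have "\<dots> < \<infinity>" using fin by (auto simp: ennreal_mult_less_top)
    finally show "(\<integral>\<^sup>+t. norm (s i t) \<partial>?M) < \<infinity>" .
  qed
  have lim: "(\<lambda>i. s i t) \<longlonglongrightarrow> f t" if t: "0 \<le> t" for t
  proof (cases "f t = 0")
    case True
    then have "s i t = 0" for i by (simp add: s_def P_def)
    with True show ?thesis by simp
  next
    case False
    have q: "(\<lambda>i. q i t) \<longlonglongrightarrow> t"
    proof (rule LIMSEQ_I)
      fix e :: real assume "0 < e"
      then obtain N where N: "inverse (real (Suc N)) < e" using reals_Archimedean by blast
      have "norm (q i t - t) < e" if "N \<le> i" for i
      proof -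
        have "\<bar>real_of_int \<lceil>real (Suc i) * t\<rceil> - real (Suc i) * t\<bar> \<le> 1"
          by linarith
        moreover have "q i t - t = (real_of_int \<lceil>real (Suc i) * t\<rceil> - real (Suc i) * t) / real (Suc i)"
          by (simp add: q_def diff_divide_distrib del: of_nat_Suc)
        ultimately have "\<bar>q i t - t\<bar> \<le> 1 / real (Suc i)"
          by (simp add: abs_divide divide_right_mono del: of_nat_Suc)
        then have "\<bar>q i t - t\<bar> \<le> inverse (real (Suc i))"
          by (simp add: inverse_eq_divide)
        also have "\<dots> \<le> inverse (real (Suc N))" using that by (intro le_imp_inverse_le) auto
        finally show ?thesis using N by simp
      qed
      then show "\<exists>N. \<forall>i\<ge>N. norm (q i t - t) < e" by blast
    qed
    have fq: "(\<lambda>i. f (q i t)) \<longlonglongrightarrow> f t"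
    proof (cases "t = 0")
      case True
      then show ?thesis by (simp add: q_def)
    next
      case False
      then have "isCont f t" using t cont by (simp add: continuous_on_eq_continuous_at)
      then show ?thesis using q by (rule isCont_tendsto_compose)
    qed
    then have "(\<lambda>i. norm (f t - f (q i t))) \<longlonglongrightarrow> norm (f t - f t)" by (intro tendsto_intros)
    then have "eventually (\<lambda>i. norm (f t - f (q i t)) < norm (f t)) sequentially"
      using False by (intro order_tendstoD) auto
    moreover have "eventually (\<lambda>i. t \<le> real i) sequentially"
      by (simp add: eventually_sequentially) (meson nat_ceiling_le_eq)
    ultimately have "eventually (\<lambda>i. f (q i t) = s i t) sequentially"
      by eventually_elim (simp add: s_def P_def)
    with fq show ?thesis by (rule Lim_transform_eventually)
  qed
  show ?thesis
  proof (rule has_strong_bochner_integral_approx[OF sbi measd])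
    show "AE t in ?M. (\<lambda>i. s i t) \<longlonglongrightarrow> f t"
      using lim by (intro AE_I2) simp
    have "(\<lambda>i. \<integral>\<^sup>+t. norm (f t - s i t) \<partial>?M) \<longlonglongrightarrow> (\<integral>\<^sup>+t. 0 \<partial>?M)"
    proof (rule nn_integral_dominated_convergence[where w = "\<lambda>t. norm (f t)"])
      show "(\<lambda>t. ennreal (norm (f t - s i t))) \<in> borel_measurable ?M" for i
        using measd by simp
      show "AE t in ?M. (\<lambda>i. ennreal (norm (f t - s i t))) \<longlonglongrightarrow> 0"
      proof (intro AE_I2)
        fix t assume "t \<in> space ?M"
        then have "(\<lambda>i. norm (f t - s i t)) \<longlonglongrightarrow> norm (f t - f t)"
          by (intro tendsto_intros lim) simp
        then have "(\<lambda>i. ennreal (norm (f t - s i t))) \<longlonglongrightarrow> ennreal (norm (f t - f t))"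
          by (rule tendsto_ennrealI)
        then show "(\<lambda>i. ennreal (norm (f t - s i t))) \<longlonglongrightarrow> 0" by simp
      qed
    qed (use le fin in \<open>auto intro!: AE_I2 ennreal_leI\<close>)
    then show "(\<lambda>i. \<integral>\<^sup>+t. norm (f t - s i t) \<partial>?M) \<longlonglongrightarrow> 0" by simp
  qed
qed

section \<open>Power kernels\<close>

text \<open>
  The kernel of the Riemann-Liouville integral of order \<open>\<gamma>\<close>, without the factor \<open>1 / \<Gamma>(\<gamma>)\<close>. It vanishes off the
  positive half-line, so that fractional integrals are convolutions over the whole real line.
\<close>

definition power_kernel :: "real \<Rightarrow> real \<Rightarrow> real" where
  "power_kernel \<gamma> u = (if 0 < u then u powr (\<gamma> - 1) else 0)"

lemma power_kernel_measurable [measurable]: "power_kernel \<gamma> \<in> borel_measurable borel"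
  unfolding power_kernel_def by measurable

lemma power_kernel_nonneg [simp]: "0 \<le> power_kernel \<gamma> u"
  by (simp add: power_kernel_def)

lemma power_kernel_nonpos [simp]: "u \<le> 0 \<Longrightarrow> power_kernel \<gamma> u = 0"
  by (simp add: power_kernel_def)

lemma power_kernel_mult: "0 < w \<Longrightarrow> power_kernel \<gamma> (w * u) = w powr (\<gamma> - 1) * power_kernel \<gamma> u"
  by (simp add: power_kernel_def powr_mult zero_less_mult_iff)

lemma power_kernel_antimono: "\<gamma> \<le> 1 \<Longrightarrow> 0 < u \<Longrightarrow> u \<le> w \<Longrightarrow> power_kernel \<gamma> w \<le> power_kernel \<gamma> u"
  by (simp add: power_kernel_def powr_mono2')

lemma power_kernel_Lipschitz:
  assumes "0 < \<gamma>" "\<gamma> \<le> 1" "0 < c" "c \<le> u" "u \<le> w"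
  shows "\<bar>power_kernel \<gamma> w - power_kernel \<gamma> u\<bar> \<le> c powr (\<gamma> - 2) * (w - u)"
proof (cases "u = w")
  case False
  then have "u < w" using assms by simp
  have "\<exists>z>u. z < w \<and> w powr (\<gamma> - 1) - u powr (\<gamma> - 1) = (w - u) * ((\<gamma> - 1) * z powr (\<gamma> - 1 - 1))"
    using assms \<open>u < w\<close> by (intro MVT2 has_real_derivative_powr) auto
  then obtain z where z: "u < z" "z < w"
    "w powr (\<gamma> - 1) - u powr (\<gamma> - 1) = (w - u) * ((\<gamma> - 1) * z powr (\<gamma> - 2))"
    by (auto simp: diff_diff_eq)
  have "\<bar>(\<gamma> - 1) * z powr (\<gamma> - 2)\<bar> \<le> 1 * c powr (\<gamma> - 2)"
    unfolding abs_mult using assms z(1) by (intro mult_mono) (auto intro!: powr_mono2')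
  then have "\<bar>(w - u) * ((\<gamma> - 1) * z powr (\<gamma> - 2))\<bar> \<le> (w - u) * c powr (\<gamma> - 2)"
    unfolding abs_mult[of "w - u"] using \<open>u < w\<close> by (intro mult_mono) auto
  then show ?thesis
    using z(3) assms by (simp add: power_kernel_def mult.commute)
qed simp

lemma nn_integral_power_kernel:
  assumes "0 < \<gamma>" "0 \<le> L"
  shows "(\<integral>\<^sup>+u. ennreal (indicator {..L} u * power_kernel \<gamma> u) \<partial>lborel) = ennreal (L powr \<gamma> / \<gamma>)"
proof -
  have "((\<lambda>u. u powr (\<gamma> - 1)) has_integral (L powr (\<gamma> - 1 + 1) / (\<gamma> - 1 + 1))) {0..L}"
    using assms by (intro has_integral_powr_from_0) auto
  then have "(\<integral>\<^sup>+u. ennreal (indicator {0..L} u * u powr (\<gamma> - 1)) \<partial>lborel) = ennreal (L powr \<gamma> / \<gamma>)"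
    by (intro nn_integral_has_integral_lebesgue) auto
  moreover have "indicator {0..L} u * u powr (\<gamma> - 1) = indicator {..L} u * power_kernel \<gamma> u" for u :: real
    by (auto simp: power_kernel_def split: split_indicator)
  ultimately show ?thesis by simp
qed

lemma has_integral_power_kernel_reflected:
  assumes "0 < \<gamma>" "a \<le> p"
  shows "has_bochner_integral lborel (\<lambda>s. indicator {a..} s * power_kernel \<gamma> (p - s)) ((p - a) powr \<gamma> / \<gamma>)"
proof (rule has_bochner_integral_nn_integral)
  have "(\<integral>\<^sup>+s. ennreal (indicator {a..} s * power_kernel \<gamma> (p - s)) \<partial>lborel)
    = (\<integral>\<^sup>+u. ennreal (indicator {a..} (p + (-1) * u) * power_kernel \<gamma> (p - (p + (-1) * u))) \<partial>lborel)"
    by (subst nn_integral_real_affine[where c = "-1" and t = p]) auto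
  also have "\<dots> = (\<integral>\<^sup>+u. ennreal (indicator {..p - a} u * power_kernel \<gamma> u) \<partial>lborel)"
    by (intro nn_integral_cong) (auto split: split_indicator)
  also have "\<dots> = ennreal ((p - a) powr \<gamma> / \<gamma>)"
    using assms by (intro nn_integral_power_kernel) auto
  finally show "(\<integral>\<^sup>+s. ennreal (indicator {a..} s * power_kernel \<gamma> (p - s)) \<partial>lborel) = ennreal ((p - a) powr \<gamma> / \<gamma>)" .
qed (use assms in auto)

lemma nn_integral_power_kernel_shifted:
  assumes "0 < \<gamma>" "0 \<le> L"
  shows "(\<integral>\<^sup>+t. ennreal (indicator {..s + L} t * power_kernel \<gamma> (t - s)) \<partial>lborel) = ennreal (L powr \<gamma> / \<gamma>)"
proof -
  have "(\<integral>\<^sup>+t. ennreal (indicator {..s + L} t * power_kernel \<gamma> (t - s)) \<partial>lborel)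
    = (\<integral>\<^sup>+u. ennreal (indicator {..s + L} (s + 1 * u) * power_kernel \<gamma> (s + 1 * u - s)) \<partial>lborel)"
    by (subst nn_integral_real_affine[where c = 1 and t = s]) auto
  also have "\<dots> = (\<integral>\<^sup>+u. ennreal (indicator {..L} u * power_kernel \<gamma> u) \<partial>lborel)"
    by (intro nn_integral_cong) (auto split: split_indicator)
  finally show ?thesis using nn_integral_power_kernel[OF assms] by simp
qed

text \<open>
  The substitution \<open>s = r + (t - r) u\<close> turns the convolution into the Beta integral, by homogeneity of
  the two kernels.
\<close>

lemma nn_integral_power_kernel_convolution:
  assumes a: "0 < a" and b: "0 < b" and w: "r < t"
  shows "(\<integral>\<^sup>+s. ennreal (power_kernel a (t - s) * power_kernel b (s - r)) \<partial>lborel)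
    = ennreal ((t - r) powr (a + b - 1) * Beta b a)"
proof -
  define w where "w = t - r"
  have w: "0 < w" using assms by (simp add: w_def)
  have "(\<integral>\<^sup>+s. ennreal (power_kernel a (t - s) * power_kernel b (s - r)) \<partial>lborel)
    = ennreal w * (\<integral>\<^sup>+u. ennreal (power_kernel a (t - (r + w * u)) * power_kernel b (r + w * u - r)) \<partial>lborel)"
    using w by (subst nn_integral_real_affine[where c = w and t = r]) auto
  also have "(\<lambda>u. power_kernel a (t - (r + w * u)) * power_kernel b (r + w * u - r))
    = (\<lambda>u. w powr (a + b - 2) * (indicator {0..1} u * (u powr (b - 1) * (1 - u) powr (a - 1))))"
  proof
    fix u
    have "t - (r + w * u) = w * (1 - u)" by (simp add: w_def algebra_simps)
    then have "power_kernel a (t - (r + w * u)) * power_kernel b (r + w * u - r)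
      = (w powr (a - 1) * w powr (b - 1)) * (power_kernel a (1 - u) * power_kernel b u)"
      using w by (simp add: power_kernel_mult)
    also have "w powr (a - 1) * w powr (b - 1) = w powr (a + b - 2)"
      by (simp add: powr_add[symmetric])
    also have "power_kernel a (1 - u) * power_kernel b u
      = indicator {0..1} u * (u powr (b - 1) * (1 - u) powr (a - 1))"
      by (auto simp: power_kernel_def split: split_indicator)
    finally show "power_kernel a (t - (r + w * u)) * power_kernel b (r + w * u - r)
      = w powr (a + b - 2) * (indicator {0..1} u * (u powr (b - 1) * (1 - u) powr (a - 1)))" .
  qed
  also have "(\<integral>\<^sup>+u. ennreal (w powr (a + b - 2) * (indicator {0..1} u * (u powr (b - 1) * (1 - u) powr (a - 1)))) \<partial>lborel)
    = ennreal (w powr (a + b - 2)) * (\<integral>\<^sup>+u. ennreal (indicator {0..1} u * (u powr (b - 1) * (1 - u) powr (a - 1))) \<partial>lborel)"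
    by (simp add: ennreal_mult' nn_integral_cmult)
  also have "(\<integral>\<^sup>+u. ennreal (indicator {0..1} u * (u powr (b - 1) * (1 - u) powr (a - 1))) \<partial>lborel) = ennreal (Beta b a)"
    using has_integral_Beta_real[OF b a] by (intro nn_integral_has_integral_lebesgue) auto
  also have "ennreal w * (ennreal (w powr (a + b - 2)) * ennreal (Beta b a)) = ennreal ((w * w powr (a + b - 2)) * Beta b a)"
    using w by (simp add: ennreal_mult' mult.assoc)
  also have "w * w powr (a + b - 2) = w powr (a + b - 1)"
    using w powr_mult_base[of w "a + b - 2"] by simp
  finally show ?thesis by (simp add: w_def)
qed

text \<open>
  For complementary orders the power of \<open>t - r\<close> disappears; this constant value is what makes Abel inversion
  work.
\<close>

lemma nn_integral_power_kernel_convolution_complementary: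
  assumes "0 < \<gamma>" "\<gamma> < 1"
  shows "(\<integral>\<^sup>+s. ennreal (power_kernel (1 - \<gamma>) (t - s) * power_kernel \<gamma> (s - r)) \<partial>lborel)
    = ennreal (indicator {..<t} r * Beta \<gamma> (1 - \<gamma>))"
proof (cases "r < t")
  case True
  then show ?thesis
    using nn_integral_power_kernel_convolution[of "1 - \<gamma>" \<gamma> r t] assms by simp
next
  case False
  then have zero: "power_kernel (1 - \<gamma>) (t - s) * power_kernel \<gamma> (s - r) = 0" for s
    by (auto simp: power_kernel_def)
  show ?thesis unfolding zero using False by simp
qed

section \<open>Fractional integrals tested against functionals\<close>

lemma borel_measurable_indicator_norm:
  fixes f :: "real \<Rightarrow> 'a::real_normed_vector"
  assumes "S \<in> sets borel" "continuous_on S f"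
  shows "(\<lambda>t. indicator S t * norm (f t)) \<in> borel_measurable borel"
  using borel_measurable_continuous_on_indicator[OF assms(1) continuous_on_norm[OF assms(2)]] by simp

lemma borel_measurable_indicator_functional:
  fixes f :: "real \<Rightarrow> 'a::real_normed_vector" and \<phi> :: "'a \<Rightarrow> real"
  assumes "S \<in> sets borel" "continuous_on S f" "bounded_linear \<phi>"
  shows "(\<lambda>t. indicator S t * \<phi> (f t)) \<in> borel_measurable borel"
  using borel_measurable_continuous_on_indicator[OF assms(1) bounded_linear.continuous_on[OF assms(3,2)]]
  by simp

text \<open>
  The function \<open>h\<close> is \<open>c\<close> times the convolution of \<open>v\<close>, cut off at \<open>0\<close>, with the kernel of order \<open>\<gamma>\<close>. The
  identity is stated for the images under functionals of norm at most one, which turns it into an identity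
  between scalar Lebesgue integrals. In the application \<open>v\<close> is \<open>x'\<close>, \<open>h\<close> its Caputo derivative of order
  \<open>\<beta>\<close>, \<open>\<gamma> = 1 - \<beta>\<close> and \<open>c = 1 / \<Gamma>(1 - \<beta>)\<close>.
\<close>

locale weak_fractional_integral =
  fixes v h :: "real \<Rightarrow> 'a::real_normed_vector" and \<gamma> c :: real
  assumes \<gamma>: "0 < \<gamma>" "\<gamma> < 1" and c: "0 < c"
    and continuous_v: "continuous_on {0<..} v"
    and finite_v: "\<And>T. (\<integral>\<^sup>+s. ennreal (indicator {0<..<T} s * norm (v s)) \<partial>lborel) < \<infinity>"
    and weak: "\<And>\<phi> t. bounded_linear \<phi> \<Longrightarrow> (\<And>y. \<bar>\<phi> y\<bar> \<le> norm y) \<Longrightarrow> 0 < t \<Longrightarrow>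
      has_bochner_integral lborel (\<lambda>s. c * (power_kernel \<gamma> (t - s) * (indicator {0<..} s * \<phi> (v s)))) (\<phi> (h t))"
begin

lemma norm_v_measurable [measurable]: "(\<lambda>s. indicator {0<..} s * norm (v s)) \<in> borel_measurable borel"
  by (intro borel_measurable_indicator_norm continuous_v) simp

lemma norm_v_measurable_Ioo [measurable]: "(\<lambda>s. indicator {0<..<T} s * norm (v s)) \<in> borel_measurable borel"
  by (intro borel_measurable_indicator_norm continuous_on_subset[OF continuous_v]) auto

lemma norm_h_le:
  assumes t: "0 < t"
  shows "ennreal (norm (h t)) \<le>
    ennreal c * (\<integral>\<^sup>+s. ennreal (power_kernel \<gamma> (t - s) * (indicator {0<..} s * norm (v s))) \<partial>lborel)"
proof -
  obtain \<phi> :: "'a \<Rightarrow> real" where \<phi>: "bounded_linear \<phi>" "\<And>y. \<bar>\<phi> y\<bar> \<le> norm y" "\<phi> (h t) = norm (h t)"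
    using norming_functional[of "h t"] by blast
  have "ennreal (norm (\<phi> (h t))) \<le>
    (\<integral>\<^sup>+s. norm (c * (power_kernel \<gamma> (t - s) * (indicator {0<..} s * \<phi> (v s)))) \<partial>lborel)"
    by (rule has_bochner_integral_norm_bound[OF weak[OF \<phi>(1,2) t]])
  also have "\<dots> \<le> (\<integral>\<^sup>+s. ennreal (c * (power_kernel \<gamma> (t - s) * (indicator {0<..} s * norm (v s)))) \<partial>lborel)"
    using c \<phi>(2) by (intro nn_integral_mono ennreal_leI) (auto simp: abs_mult intro!: mult_left_mono)
  also have "\<dots> = ennreal c * (\<integral>\<^sup>+s. ennreal (power_kernel \<gamma> (t - s) * (indicator {0<..} s * norm (v s))) \<partial>lborel)"
    using c by (subst nn_integral_cmult[symmetric], measurable) (simp add: ennreal_mult')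
  finally show ?thesis using \<phi>(3) by simp
qed

text \<open>
  By Tonelli's theorem: for fixed \<open>s\<close> the kernel contributes at most its integral over an interval of length
  \<open>T\<close>.
\<close>

lemma finite_h: "(\<integral>\<^sup>+t. ennreal (indicator {0<..<T} t * norm (h t)) \<partial>lborel) < \<infinity>"
proof (cases "0 \<le> T")
  case True
  let ?n = "\<lambda>s. indicator {0<..} s * norm (v s)"
  have "(\<integral>\<^sup>+t. ennreal (indicator {0<..<T} t * norm (h t)) \<partial>lborel)
    \<le> (\<integral>\<^sup>+t. (\<integral>\<^sup>+s. ennreal c * ennreal (indicator {0<..<T} t * (power_kernel \<gamma> (t - s) * ?n s)) \<partial>lborel) \<partial>lborel)"
  proof (rule nn_integral_mono)
    fix t :: real
    show "ennreal (indicator {0<..<T} t * norm (h t)) \<le> (\<integral>\<^sup>+s. ennreal c * ennreal (indicator {0<..<T} t * (power_kernel \<gamma> (t - s) * ?n s)) \<partial>lborel)"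
      using norm_h_le[of t] by (cases "t \<in> {0<..<T}") (auto simp: nn_integral_cmult)
  qed
  also have "\<dots> = (\<integral>\<^sup>+s. (\<integral>\<^sup>+t. ennreal c * ennreal (indicator {0<..<T} t * (power_kernel \<gamma> (t - s) * ?n s)) \<partial>lborel) \<partial>lborel)"
    by (rule lborel_pair.Fubini') measurable
  also have "\<dots> \<le> (\<integral>\<^sup>+s. ennreal c * (ennreal (T powr \<gamma> / \<gamma>) * ennreal (indicator {0<..<T} s * norm (v s))) \<partial>lborel)"
  proof (rule nn_integral_mono)
    fix s :: real
    have "(\<integral>\<^sup>+t. ennreal c * ennreal (indicator {0<..<T} t * (power_kernel \<gamma> (t - s) * ?n s)) \<partial>lborel)
      \<le> (\<integral>\<^sup>+t. ennreal c * (ennreal (indicator {..s + T} t * power_kernel \<gamma> (t - s)) * ennreal (indicator {0<..<T} s * norm (v s))) \<partial>lborel)"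
    proof (intro nn_integral_mono mult_left_mono)
      fix t
      have "indicator {0<..<T} t * (power_kernel \<gamma> (t - s) * ?n s)
        \<le> indicator {..s + T} t * power_kernel \<gamma> (t - s) * (indicator {0<..<T} s * norm (v s))"
        by (cases "s < t") (auto split: split_indicator)
      then show "ennreal (indicator {0<..<T} t * (power_kernel \<gamma> (t - s) * ?n s))
        \<le> ennreal (indicator {..s + T} t * power_kernel \<gamma> (t - s)) * ennreal (indicator {0<..<T} s * norm (v s))"
        by (subst ennreal_mult'[symmetric]) (auto intro: ennreal_leI)
    qed simp
    also have "\<dots> = ennreal c * (ennreal (T powr \<gamma> / \<gamma>) * ennreal (indicator {0<..<T} s * norm (v s)))"
      by (simp add: nn_integral_cmult nn_integral_multc nn_integral_power_kernel_shifted \<gamma> True)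
    finally show "(\<integral>\<^sup>+t. ennreal c * ennreal (indicator {0<..<T} t * (power_kernel \<gamma> (t - s) * ?n s)) \<partial>lborel)
      \<le> ennreal c * (ennreal (T powr \<gamma> / \<gamma>) * ennreal (indicator {0<..<T} s * norm (v s)))" .
  qed
  also have "\<dots> = ennreal c * (ennreal (T powr \<gamma> / \<gamma>) * (\<integral>\<^sup>+s. ennreal (indicator {0<..<T} s * norm (v s)) \<partial>lborel))"
    by (simp add: nn_integral_cmult)
  also have "\<dots> < \<infinity>" using finite_v[of T] by (simp add: ennreal_mult_less_top)
  finally show ?thesis .
qed simp

text \<open>
  Below \<open>a\<close>, where \<open>v\<close> is only integrable, the arguments of both kernels are at least \<open>a\<close>, and there the
  kernel is Lipschitz continuous. Above \<open>a\<close>, \<open>v\<close> is bounded and the kernel decreases, so its variation is an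
  explicit difference of powers, bounded by a multiple of \<open>(t - t') powr \<gamma>\<close>.
\<close>

lemma h_increment:
  assumes "0 < a" "2 * a \<le> t'" "t' \<le> t" "t \<le> b"
    and U: "\<And>s. a \<le> s \<Longrightarrow> s \<le> b \<Longrightarrow> norm (v s) \<le> U"
  shows "norm (h t - h t') \<le> c * (a powr (\<gamma> - 2) * (t - t') * (\<integral>s. indicator {0<..<a} s * norm (v s) \<partial>lborel)
    + U * (2 * ((t - t') powr \<gamma> / \<gamma>)))"
proof -
  let ?n = "\<lambda>s. indicator {0<..<a} s * norm (v s)"
  let ?K = "\<lambda>q p s. indicator {q..} s * power_kernel \<gamma> (p - s)"
  let ?R = "\<lambda>s. c * (a powr (\<gamma> - 2) * (t - t') * ?n s + U * (?K a t' s - ?K a t s + 2 * ?K t' t s))"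
  obtain \<phi> :: "'a \<Rightarrow> real" where \<phi>: "bounded_linear \<phi>" "\<And>y. \<bar>\<phi> y\<bar> \<le> norm y" "\<phi> (h t - h t') = norm (h t - h t')"
    using norming_functional[of "h t - h t'"] by blast
  let ?p = "\<lambda>s. indicator {0<..} s * \<phi> (v s)"
  have "0 \<le> norm (v t')" by simp
  also have "\<dots> \<le> U" using assms by (intro U) auto
  finally have U0: "0 \<le> U" .
  have n: "integrable lborel ?n"
    by (rule integrableI_nonneg) (use finite_v[of a] in auto)
  have R: "has_bochner_integral lborel ?R (c * (a powr (\<gamma> - 2) * (t - t') * integral\<^sup>L lborel ?n
      + U * ((t' - a) powr \<gamma> / \<gamma> - (t - a) powr \<gamma> / \<gamma> + 2 * ((t - t') powr \<gamma> / \<gamma>))))"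
    using assms \<gamma>
    by (intro has_bochner_integral_mult_right has_bochner_integral_add has_bochner_integral_diff
        has_integral_power_kernel_reflected has_bochner_integral_integrable n) auto
  have "has_bochner_integral lborel
      (\<lambda>s. c * (power_kernel \<gamma> (t - s) * ?p s) - c * (power_kernel \<gamma> (t' - s) * ?p s)) (\<phi> (h t) - \<phi> (h t'))"
    using assms by (intro has_bochner_integral_diff weak \<phi>) auto
  moreover have "\<phi> (h t) - \<phi> (h t') = norm (h t - h t')"
    using \<phi>(3) by (simp add: linear_diff[OF bounded_linear.linear[OF \<phi>(1)]])
  ultimately have D: "has_bochner_integral lborel
      (\<lambda>s. c * (power_kernel \<gamma> (t - s) * ?p s) - c * (power_kernel \<gamma> (t' - s) * ?p s)) (norm (h t - h t'))"
    by simp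
  \<comment> \<open>The doubled last kernel compensates for the negative second one on the interval from t' to t.\<close>
  have le: "c * (power_kernel \<gamma> (t - s) * ?p s) - c * (power_kernel \<gamma> (t' - s) * ?p s) \<le> ?R s" for s
  proof -
    let ?D = "power_kernel \<gamma> (t - s) - power_kernel \<gamma> (t' - s)"
    have p: "\<bar>?p s\<bar> \<le> indicator {0<..} s * norm (v s)"
      using \<phi>(2) by (auto simp: abs_mult split: split_indicator)
    have "\<bar>?D\<bar> * \<bar>?p s\<bar> \<le> a powr (\<gamma> - 2) * (t - t') * ?n s + U * (?K a t' s - ?K a t s + 2 * ?K t' t s)"
    proof (cases "s < a")
      case True
      have "\<bar>?D\<bar> \<le> a powr (\<gamma> - 2) * (t - s - (t' - s))"
        using assms \<gamma> True by (intro power_kernel_Lipschitz) auto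
      then have "\<bar>?D\<bar> * \<bar>?p s\<bar> \<le> (a powr (\<gamma> - 2) * (t - t')) * (indicator {0<..} s * norm (v s))"
        using p assms by (intro mult_mono) auto
      then show ?thesis using True assms by (auto split: split_indicator)
    next
      case False
      have K: "\<bar>?D\<bar> \<le> ?K a t' s - ?K a t s + 2 * ?K t' t s"
      proof (cases "s < t'")
        case True
        then have "power_kernel \<gamma> (t - s) \<le> power_kernel \<gamma> (t' - s)"
          using assms \<gamma> by (intro power_kernel_antimono) auto
        then show ?thesis using True False by simp
      next
        case False
        then show ?thesis using \<open>\<not> s < a\<close> by simp
      qed
      show ?thesis
      proof (cases "s < t")
        case True
        have "norm (v s) \<le> U" using True False assms by (intro U) auto
        then have "\<bar>?p s\<bar> \<le> U" using p U0 by (auto split: split_indicator_asm)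
        then have "\<bar>?D\<bar> * \<bar>?p s\<bar> \<le> (?K a t' s - ?K a t s + 2 * ?K t' t s) * U"
          using K by (intro mult_mono) auto
        then show ?thesis using False by (simp add: mult.commute)
      next
        case False
        then have "?D = 0" using assms by simp
        moreover have "0 \<le> U * (?K a t' s - ?K a t s + 2 * ?K t' t s)"
          using K U0 by (intro mult_nonneg_nonneg) auto
        ultimately show ?thesis using assms by simp
      qed
    qed
    then have "?D * ?p s \<le> a powr (\<gamma> - 2) * (t - t') * ?n s + U * (?K a t' s - ?K a t s + 2 * ?K t' t s)"
      using abs_le_D1[of "?D * ?p s"] unfolding abs_mult by simp
    then have "c * (?D * ?p s) \<le> ?R s"
      using c by (intro mult_left_mono) auto
    then show ?thesis by (simp add: algebra_simps)
  qed
  have "norm (h t - h t') \<le> c * (a powr (\<gamma> - 2) * (t - t') * integral\<^sup>L lborel ?n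
      + U * ((t' - a) powr \<gamma> / \<gamma> - (t - a) powr \<gamma> / \<gamma> + 2 * ((t - t') powr \<gamma> / \<gamma>)))"
    using integral_mono[OF integrable.intros[OF D] integrable.intros[OF R] le]
    by (simp only: has_bochner_integral_integral_eq[OF D] has_bochner_integral_integral_eq[OF R])
  also have "\<dots> \<le> c * (a powr (\<gamma> - 2) * (t - t') * integral\<^sup>L lborel ?n + U * (2 * ((t - t') powr \<gamma> / \<gamma>)))"
  proof -
    have "(t' - a) powr \<gamma> / \<gamma> \<le> (t - a) powr \<gamma> / \<gamma>"
      using assms \<gamma> by (intro divide_right_mono powr_mono2) auto
    then show ?thesis
      using c U0 by (intro mult_left_mono add_left_mono) auto
  qed
  finally show ?thesis .
qed

text \<open>
  The increments of \<open>h\<close> near \<open>t0\<close> are bounded by a combination of \<open>\<bar>t - t0\<bar>\<close> and its power \<open>\<gamma>\<close>.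
\<close>

lemma continuous_h: "continuous_on {0<..} h"
proof -
  have "isCont h t0" if t0: "0 < t0" for t0
  proof -
    define a where "a = t0 / 4"
    define b where "b = 2 * t0"
    have "compact (v ` {a..b})"
      using t0 by (intro compact_continuous_image continuous_on_subset[OF continuous_v]) (auto simp: a_def)
    then obtain U where U: "\<And>s. a \<le> s \<Longrightarrow> s \<le> b \<Longrightarrow> norm (v s) \<le> U"
      by (meson atLeastAtMost_iff bounded_iff compact_imp_bounded imageI)
    define B where "B d = c * (a powr (\<gamma> - 2) * d * (\<integral>s. indicator {0<..<a} s * norm (v s) \<partial>lborel)
      + U * (2 * (d powr \<gamma> / \<gamma>)))" for d
    have bound: "norm (h t - h t0) \<le> B \<bar>t - t0\<bar>" if "t \<in> {2 * a<..<b}" for t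
    proof (cases "t0 \<le> t")
      case True
      then show ?thesis
        using h_increment[of a t0 t b U] U t0 that by (simp add: B_def a_def)
    next
      case False
      then show ?thesis
        using h_increment[of a t t0 b U] U t0 that by (simp add: B_def a_def b_def norm_minus_commute)
    qed
    have "((\<lambda>t. B \<bar>t - t0\<bar>) \<longlongrightarrow> B \<bar>t0 - t0\<bar>) (at t0)"
    proof -
      have "((\<lambda>t. \<bar>t - t0\<bar> powr \<gamma>) \<longlongrightarrow> \<bar>t0 - t0\<bar> powr \<gamma>) (at t0)"
        using \<gamma> by (intro tendsto_powr2 tendsto_intros) (auto)
      moreover have "((\<lambda>t. \<bar>t - t0\<bar>) \<longlongrightarrow> \<bar>t0 - t0\<bar>) (at t0)"
        by (intro tendsto_intros)
      ultimately show ?thesis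
        unfolding B_def using \<gamma> by (intro tendsto_intros) auto
    qed
    then have "((\<lambda>t. B \<bar>t - t0\<bar>) \<longlongrightarrow> 0) (at t0)" by (simp add: B_def)
    moreover have "eventually (\<lambda>t. norm (h t - h t0) \<le> B \<bar>t - t0\<bar>) (at t0)"
    proof (rule eventually_at_in_open[THEN eventually_mono])
      show "open {2 * a<..<b}" "t0 \<in> {2 * a<..<b}" using t0 by (auto simp: a_def b_def)
    qed (use bound in auto)
    ultimately have "((\<lambda>t. h t - h t0) \<longlongrightarrow> 0) (at t0)"
      by (rule Lim_null_comparison[rotated])
    then show ?thesis by (simp add: isCont_def LIM_zero_iff)
  qed
  then show ?thesis by (intro continuous_at_imp_continuous_on) auto
qed

text \<open>
  Convolving \<open>h\<close> with the complementary kernel and exchanging the integrals leaves a constant multiple of the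
  integral of \<open>v\<close>, as the two kernels convolve to the constant \<open>Beta \<gamma> (1 - \<gamma>)\<close>.
\<close>

lemma Abel_inversion_bound:
  assumes \<phi>: "bounded_linear \<phi>" "\<And>y. \<bar>\<phi> y\<bar> \<le> norm y"
  shows "ennreal (c * Beta \<gamma> (1 - \<gamma>) * \<bar>\<integral>r. indicator {0<..<T} r * \<phi> (v r) \<partial>lborel\<bar>)
    \<le> (\<integral>\<^sup>+t. ennreal (power_kernel (1 - \<gamma>) (T - t) * (indicator {0<..} t * norm (h t))) \<partial>lborel)"
proof -
  let ?p = "\<lambda>r. indicator {0<..} r * \<phi> (v r)"
  let ?B = "Beta \<gamma> (1 - \<gamma>)"
  have [measurable]: "?p \<in> borel_measurable borel"
    by (intro borel_measurable_indicator_functional continuous_v \<phi>(1)) simp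
  have B: "0 < ?B" using \<gamma> by (simp add: Beta_def Gamma_real_pos)
  define G where "G t r = power_kernel (1 - \<gamma>) (T - t) * (c * (power_kernel \<gamma> (t - r) * ?p r))" for t r
  have [measurable]: "case_prod G \<in> borel_measurable (lborel \<Otimes>\<^sub>M lborel)"
    unfolding G_def by measurable
  have nn: "(\<integral>\<^sup>+t. ennreal (power_kernel (1 - \<gamma>) (T - t) * power_kernel \<gamma> (t - r)) \<partial>lborel)
    = ennreal (indicator {..<T} r * ?B)" for r
    by (rule nn_integral_power_kernel_convolution_complementary[OF \<gamma>])
  have inner: "(\<integral>t. G t r \<partial>lborel) = c * ?B * (indicator {0<..<T} r * \<phi> (v r))" for r
  proof -
    have "has_bochner_integral lborel (\<lambda>t. power_kernel (1 - \<gamma>) (T - t) * power_kernel \<gamma> (t - r)) (indicator {..<T} r * ?B)"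
      by (rule has_bochner_integral_nn_integral) (use nn B in auto)
    then have "has_bochner_integral lborel (\<lambda>t. (power_kernel (1 - \<gamma>) (T - t) * power_kernel \<gamma> (t - r)) * (c * ?p r)) (indicator {..<T} r * ?B * (c * ?p r))"
      by (rule has_bochner_integral_mult_left)
    moreover have "(\<lambda>t. (power_kernel (1 - \<gamma>) (T - t) * power_kernel \<gamma> (t - r)) * (c * ?p r)) = (\<lambda>t. G t r)"
      by (simp add: G_def fun_eq_iff mult_ac)
    ultimately have "(\<integral>t. G t r \<partial>lborel) = indicator {..<T} r * ?B * (c * ?p r)"
      by (simp add: has_bochner_integral_integral_eq)
    then show ?thesis by (auto split: split_indicator)
  qed
  have int: "integrable (lborel \<Otimes>\<^sub>M lborel) (case_prod G)"
  proof (rule integrableI_bounded)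
    have "(\<integral>\<^sup>+z. ennreal (norm (case_prod G z)) \<partial>(lborel \<Otimes>\<^sub>M lborel))
      = (\<integral>\<^sup>+r. (\<integral>\<^sup>+t. ennreal (norm (G t r)) \<partial>lborel) \<partial>lborel)"
      by (subst lborel_pair.nn_integral_snd[symmetric]) auto
    also have "\<dots> \<le> (\<integral>\<^sup>+r. ennreal (c * ?B) * ennreal (indicator {0<..<T} r * norm (v r)) \<partial>lborel)"
    proof (rule nn_integral_mono)
      fix r
      have "(\<integral>\<^sup>+t. ennreal (norm (G t r)) \<partial>lborel)
        = (\<integral>\<^sup>+t. ennreal (power_kernel (1 - \<gamma>) (T - t) * power_kernel \<gamma> (t - r)) * ennreal (c * \<bar>?p r\<bar>) \<partial>lborel)"
        using c by (intro nn_integral_cong) (simp add: G_def abs_mult ennreal_mult[symmetric] mult_ac)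
      also have "\<dots> = ennreal (indicator {..<T} r * ?B) * ennreal (c * \<bar>?p r\<bar>)"
        by (simp add: nn_integral_multc nn)
      also have "\<dots> \<le> ennreal (c * ?B) * ennreal (indicator {0<..<T} r * norm (v r))"
        using c B \<phi>(2)[of "v r"]
        by (auto simp: ennreal_mult[symmetric] abs_mult mult_ac split: split_indicator intro!: ennreal_leI mult_left_mono)
      finally show "(\<integral>\<^sup>+t. ennreal (norm (G t r)) \<partial>lborel) \<le> ennreal (c * ?B) * ennreal (indicator {0<..<T} r * norm (v r))" .
    qed
    also have "\<dots> = ennreal (c * ?B) * (\<integral>\<^sup>+r. ennreal (indicator {0<..<T} r * norm (v r)) \<partial>lborel)"
      by (intro nn_integral_cmult) simp
    also have "\<dots> < \<infinity>" using finite_v[of T] by (simp add: ennreal_mult_less_top)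
    finally show "(\<integral>\<^sup>+z. ennreal (norm (case_prod G z)) \<partial>(lborel \<Otimes>\<^sub>M lborel)) < \<infinity>" .
  qed simp
  have outer: "(\<integral>r. G t r \<partial>lborel) = power_kernel (1 - \<gamma>) (T - t) * (indicator {0<..} t * \<phi> (h t))" for t
  proof (cases "0 < t")
    case True
    then show ?thesis
      using has_bochner_integral_integral_eq[OF weak[OF \<phi> True]] by (simp add: G_def)
  next
    case False
    then have "G t r = 0" for r by (auto simp: G_def power_kernel_def split: split_indicator)
    with False show ?thesis by simp
  qed
  have eq: "c * ?B * (\<integral>r. indicator {0<..<T} r * \<phi> (v r) \<partial>lborel)
    = (\<integral>t. power_kernel (1 - \<gamma>) (T - t) * (indicator {0<..} t * \<phi> (h t)) \<partial>lborel)"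
    using lborel_pair.Fubini_integral[OF int] by (simp add: inner outer)
  have "integrable lborel (\<lambda>t. \<integral>r. G t r \<partial>lborel)"
    using lborel_pair.integrable_fst[OF int] .
  then have "integrable lborel (\<lambda>t. power_kernel (1 - \<gamma>) (T - t) * (indicator {0<..} t * \<phi> (h t)))"
    by (simp add: outer)
  from integral_norm_bound_ennreal[OF this]
  have "ennreal \<bar>c * ?B * (\<integral>r. indicator {0<..<T} r * \<phi> (v r) \<partial>lborel)\<bar>
    \<le> (\<integral>\<^sup>+t. norm (power_kernel (1 - \<gamma>) (T - t) * (indicator {0<..} t * \<phi> (h t))) \<partial>lborel)"
    by (simp add: eq)
  also have "\<dots> \<le> (\<integral>\<^sup>+t. ennreal (power_kernel (1 - \<gamma>) (T - t) * (indicator {0<..} t * norm (h t))) \<partial>lborel)"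
    using \<phi>(2) by (intro nn_integral_mono ennreal_leI) (auto simp: abs_mult intro!: mult_left_mono)
  finally show ?thesis using c B by (simp add: abs_mult)
qed

end

section \<open>Exponential bounds for antiderivatives\<close>

lemma exponentially_boundedI:
  assumes "0 < L" "0 < \<delta>" "0 \<le> T" "\<And>t. T \<le> t \<Longrightarrow> norm (f t) \<le> L * exp (\<delta> * t)"
  shows "exponentially_bounded f"
  unfolding exponentially_bounded_def using assms by blast

lemma exponentially_boundedE:
  assumes "exponentially_bounded f"
  obtains L \<delta> T where "0 < L" "0 < \<delta>" "0 \<le> T" "\<And>t. T \<le> t \<Longrightarrow> norm (f t) \<le> L * exp (\<delta> * t)"
  using assms unfolding exponentially_bounded_def by blast

lemma increment_bound:
  fixes x :: "real \<Rightarrow> 'a::banach"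
  assumes "a \<le> b" and "continuous_on {a..b} x"
    and "\<And>s. a < s \<Longrightarrow> s < b \<Longrightarrow> (x has_vector_derivative v s) (at s)"
    and "0 \<le> K" and "\<And>s. a < s \<Longrightarrow> s < b \<Longrightarrow> norm (v s) \<le> K"
  shows "norm (x b - x a) \<le> K * (b - a)"
proof -
  have "(v has_integral (x b - x a)) {a..b}"
    using assms by (intro fundamental_theorem_of_calculus_interior) auto
  then have "norm (x b - x a) \<le> K * measure lborel {a..b}"
    using assms by (intro has_integral_bound_real[where S = "{a, b}" and f = v]) auto
  then show ?thesis using assms(1) by simp
qed

lemma integral_functional_derivative:
  fixes x :: "real \<Rightarrow> 'a::real_normed_vector" and \<phi> :: "'a \<Rightarrow> real"
  assumes "0 \<le> T" and cont: "continuous_on {0..T} x"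
    and deriv: "\<And>s. 0 < s \<Longrightarrow> s < T \<Longrightarrow> (x has_vector_derivative v s) (at s)"
    and \<phi>: "bounded_linear \<phi>"
    and int: "integrable lborel (\<lambda>r. indicator {0<..<T} r * \<phi> (v r))"
  shows "(\<integral>r. indicator {0<..<T} r * \<phi> (v r) \<partial>lborel) = \<phi> (x T) - \<phi> (x 0)"
proof -
  interpret \<phi>: bounded_linear \<phi> by fact
  have "((\<lambda>s. \<phi> (v s)) has_integral (\<phi> (x T) - \<phi> (x 0))) {0..T}"
    using assms
    by (intro fundamental_theorem_of_calculus_interior \<phi>.continuous_on \<phi>.has_vector_derivative) auto
  then have *: "((\<lambda>s. \<phi> (v s)) has_integral (\<phi> (x T) - \<phi> (x 0))) {0<..<T}"
    by (simp add: has_integral_Icc_iff_Ioo)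
  have "set_integrable lborel {0<..<T} (\<lambda>s. \<phi> (v s))"
    using int by (simp add: set_integrable_def)
  from set_borel_integral_eq_integral(2)[OF this] integral_unique[OF *] show ?thesis
    by (simp add: set_lebesgue_integral_def)
qed

context weak_fractional_integral
begin

text \<open>
  Abel inversion for the functional that norms \<open>x T - x 0\<close>.
\<close>

lemma primitive_bound:
  fixes x :: "real \<Rightarrow> 'a"
  assumes T: "0 \<le> T" and cont: "continuous_on {0..T} x"
    and deriv: "\<And>s. 0 < s \<Longrightarrow> s < T \<Longrightarrow> (x has_vector_derivative v s) (at s)"
  shows "ennreal (c * Beta \<gamma> (1 - \<gamma>) * norm (x T - x 0))
    \<le> (\<integral>\<^sup>+t. ennreal (power_kernel (1 - \<gamma>) (T - t) * (indicator {0<..} t * norm (h t))) \<partial>lborel)"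
proof -
  obtain \<phi> :: "'a \<Rightarrow> real" where \<phi>: "bounded_linear \<phi>" "\<And>y. \<bar>\<phi> y\<bar> \<le> norm y" "\<phi> (x T - x 0) = norm (x T - x 0)"
    using norming_functional[of "x T - x 0"] by blast
  have int: "integrable lborel (\<lambda>r. indicator {0<..<T} r * \<phi> (v r))"
  proof (rule integrableI_bounded)
    have "(\<lambda>s. indicator {0<..<T} s * \<phi> (v s)) \<in> borel_measurable borel"
      by (intro borel_measurable_indicator_functional continuous_on_subset[OF continuous_v] \<phi>(1)) auto
    then show "(\<lambda>s. indicator {0<..<T} s * \<phi> (v s)) \<in> borel_measurable lborel" by simp
    have "(\<integral>\<^sup>+r. ennreal (norm (indicator {0<..<T} r * \<phi> (v r))) \<partial>lborel)
      \<le> (\<integral>\<^sup>+r. ennreal (indicator {0<..<T} r * norm (v r)) \<partial>lborel)"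
      using \<phi>(2) by (intro nn_integral_mono ennreal_leI) (auto simp: abs_mult intro!: mult_left_mono)
    also note finite_v
    finally show "(\<integral>\<^sup>+r. ennreal (norm (indicator {0<..<T} r * \<phi> (v r))) \<partial>lborel) < \<infinity>" .
  qed
  have "(\<integral>r. indicator {0<..<T} r * \<phi> (v r) \<partial>lborel) = \<phi> (x T) - \<phi> (x 0)"
    by (rule integral_functional_derivative[OF T cont deriv \<phi>(1) int])
  also have "\<dots> = norm (x T - x 0)"
    using \<phi>(3) by (simp add: linear_diff[OF bounded_linear.linear[OF \<phi>(1)]])
  finally show ?thesis
    using Abel_inversion_bound[OF \<phi>(1,2), of T] by simp
qed

text \<open>
  Split the weakly singular integral of \<open>norm (h t)\<close> at the time \<open>T0\<close> from which the exponential bound holds.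
  For \<open>T \<ge> T0 + 1\<close> the kernel is at most \<open>1\<close> before \<open>T0\<close>, where \<open>h\<close> is integrable; after \<open>T0\<close> the bound of \<open>h\<close> is
  at most its value at \<open>T\<close>, and the kernel contributes a power of \<open>T\<close>. That power is absorbed by raising the
  exponent by \<open>1\<close>.
\<close>

lemma exponentially_bounded_primitive:
  fixes x :: "real \<Rightarrow> 'a"
  assumes cont: "continuous_on {0..} x"
    and deriv: "\<And>s. 0 < s \<Longrightarrow> (x has_vector_derivative v s) (at s)"
    and h: "exponentially_bounded h"
  shows "exponentially_bounded x"
proof -
  obtain L \<delta> T0 where L: "0 < L" "0 < \<delta>" "0 \<le> T0" and bound: "\<And>t. T0 \<le> t \<Longrightarrow> norm (h t) \<le> L * exp (\<delta> * t)"
    by (rule exponentially_boundedE[OF h]) blast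
  let ?k = "c * Beta \<gamma> (1 - \<gamma>)"
  have k: "0 < ?k" using \<gamma> c by (simp add: Beta_def Gamma_real_pos)
  obtain H where H: "0 \<le> H" "(\<integral>\<^sup>+t. ennreal (indicator {0<..<T0} t * norm (h t)) \<partial>lborel) = ennreal H"
    using finite_h[of T0] by (metis ennreal_cases less_irrefl infinity_ennreal_def)
  have [measurable]: "(\<lambda>t. indicator {0<..<T0} t * norm (h t)) \<in> borel_measurable borel"
    by (intro borel_measurable_indicator_norm continuous_on_subset[OF continuous_h]) auto
  have est: "norm (x T) \<le> (norm (x 0) + (H + L / (1 - \<gamma>)) / ?k) * exp ((\<delta> + 1) * T)" if T: "T0 + 1 \<le> T" for T
  proof -
    have "ennreal (?k * norm (x T - x 0))
      \<le> (\<integral>\<^sup>+t. ennreal (power_kernel (1 - \<gamma>) (T - t) * (indicator {0<..} t * norm (h t))) \<partial>lborel)"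
      using T L by (intro primitive_bound continuous_on_subset[OF cont] deriv) auto
    also have "\<dots> \<le> (\<integral>\<^sup>+t. ennreal (indicator {0<..<T0} t * norm (h t))
        + ennreal (L * exp (\<delta> * T)) * ennreal (indicator {0..} t * power_kernel (1 - \<gamma>) (T - t)) \<partial>lborel)"
    proof (rule nn_integral_mono)
      fix t
      have "power_kernel (1 - \<gamma>) (T - t) * (indicator {0<..} t * norm (h t))
        \<le> indicator {0<..<T0} t * norm (h t) + L * exp (\<delta> * T) * (indicator {0..} t * power_kernel (1 - \<gamma>) (T - t))"
      proof (cases "0 < t \<and> t < T")
        case False
        then show ?thesis using L by (auto split: split_indicator)
      next
        case t: True
        show ?thesis
        proof (cases "t < T0")
          case True
          have "power_kernel (1 - \<gamma>) (T - t) \<le> power_kernel (1 - \<gamma>) 1"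
            using \<gamma> T True by (intro power_kernel_antimono) auto
          then have "power_kernel (1 - \<gamma>) (T - t) * norm (h t) \<le> 1 * norm (h t)"
            by (intro mult_right_mono) (auto simp: power_kernel_def)
          moreover have "0 \<le> L * exp (\<delta> * T) * power_kernel (1 - \<gamma>) (T - t)"
            using L by auto
          ultimately show ?thesis using t True by simp
        next
          case False
          have "norm (h t) \<le> L * exp (\<delta> * t)" using False by (intro bound) auto
          also have "\<dots> \<le> L * exp (\<delta> * T)" using L t by auto
          finally have "power_kernel (1 - \<gamma>) (T - t) * norm (h t) \<le> power_kernel (1 - \<gamma>) (T - t) * (L * exp (\<delta> * T))"
            by (intro mult_left_mono) auto
          then show ?thesis using t False by (simp add: mult.commute)
        qed
      qed
      then have "ennreal (power_kernel (1 - \<gamma>) (T - t) * (indicator {0<..} t * norm (h t)))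
        \<le> ennreal (indicator {0<..<T0} t * norm (h t) + L * exp (\<delta> * T) * (indicator {0..} t * power_kernel (1 - \<gamma>) (T - t)))"
        by (rule ennreal_leI)
      also have "\<dots> = ennreal (indicator {0<..<T0} t * norm (h t))
          + ennreal (L * exp (\<delta> * T)) * ennreal (indicator {0..} t * power_kernel (1 - \<gamma>) (T - t))"
        using L by (subst ennreal_plus) (auto simp: ennreal_mult')
      finally show "ennreal (power_kernel (1 - \<gamma>) (T - t) * (indicator {0<..} t * norm (h t)))
        \<le> ennreal (indicator {0<..<T0} t * norm (h t))
          + ennreal (L * exp (\<delta> * T)) * ennreal (indicator {0..} t * power_kernel (1 - \<gamma>) (T - t))" .
    qed
    also have "\<dots> = ennreal H + ennreal (L * exp (\<delta> * T)) * ennreal (T powr (1 - \<gamma>) / (1 - \<gamma>))"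
    proof -
      have "has_bochner_integral lborel (\<lambda>s. indicator {0..} s * power_kernel (1 - \<gamma>) (T - s)) ((T - 0) powr (1 - \<gamma>) / (1 - \<gamma>))"
        using \<gamma> T L by (intro has_integral_power_kernel_reflected) auto
      then have "(\<integral>\<^sup>+t. ennreal (indicator {0..} t * power_kernel (1 - \<gamma>) (T - t)) \<partial>lborel) = ennreal (T powr (1 - \<gamma>) / (1 - \<gamma>))"
        by (subst nn_integral_eq_integral) (auto simp: has_bochner_integral_iff)
      then show ?thesis
        by (subst nn_integral_add, measurable) (simp add: nn_integral_cmult H)
    qed
    also have "\<dots> = ennreal (H + L * exp (\<delta> * T) * (T powr (1 - \<gamma>) / (1 - \<gamma>)))"
      using H L \<gamma> by (simp add: ennreal_mult'[symmetric])
    finally have "?k * norm (x T - x 0) \<le> H + L * exp (\<delta> * T) * (T powr (1 - \<gamma>) / (1 - \<gamma>))"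
      using H L \<gamma> by (subst (asm) ennreal_le_iff) auto
    also have "\<dots> \<le> H * exp ((\<delta> + 1) * T) + (L / (1 - \<gamma>)) * exp ((\<delta> + 1) * T)"
    proof (rule add_mono)
      show "H \<le> H * exp ((\<delta> + 1) * T)"
        using H L T by (simp add: mult_le_cancel_left1)
      have "T powr (1 - \<gamma>) \<le> T powr 1"
        using T L \<gamma> by (intro powr_mono) auto
      also have "\<dots> \<le> exp T"
        using T L exp_ge_add_one_self[of T] by (simp del: exp_ge_add_one_self)
      finally have "L * exp (\<delta> * T) * T powr (1 - \<gamma>) \<le> L * exp (\<delta> * T) * exp T"
        using L by (intro mult_left_mono) auto
      then have "L * exp (\<delta> * T) * T powr (1 - \<gamma>) / (1 - \<gamma>) \<le> L * exp (\<delta> * T) * exp T / (1 - \<gamma>)"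
        using \<gamma> by (intro divide_right_mono) auto
      also have "L * exp (\<delta> * T) * exp T = L * exp ((\<delta> + 1) * T)"
        by (simp add: exp_add[symmetric] algebra_simps)
      finally show "L * exp (\<delta> * T) * (T powr (1 - \<gamma>) / (1 - \<gamma>)) \<le> (L / (1 - \<gamma>)) * exp ((\<delta> + 1) * T)"
        by simp
    qed
    finally have "norm (x T - x 0) \<le> (H + L / (1 - \<gamma>)) * exp ((\<delta> + 1) * T) / ?k"
      using k by (simp add: pos_le_divide_eq algebra_simps)
    moreover have "norm (x T) \<le> norm (x 0) + norm (x T - x 0)"
      using norm_triangle_ineq[of "x 0" "x T - x 0"] by simp
    moreover have "norm (x 0) \<le> norm (x 0) * exp ((\<delta> + 1) * T)"
      using L T by (simp add: mult_le_cancel_left1)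
    ultimately show ?thesis by (simp add: algebra_simps)
  qed
  show ?thesis
  proof (rule exponentially_boundedI)
    show "0 < norm (x 0) + (H + L / (1 - \<gamma>)) / ?k"
      using k H L \<gamma> by (intro add_nonneg_pos divide_pos_pos add_nonneg_pos) auto
    show "0 < \<delta> + 1" "0 \<le> T0 + 1" using L by auto
  qed (rule est)
qed

end

lemma exponentially_bounded_antiderivative:
  fixes x :: "real \<Rightarrow> 'a::banach"
  assumes cont: "continuous_on {0..} x"
    and deriv: "\<And>s. 0 < s \<Longrightarrow> (x has_vector_derivative v s) (at s)"
    and v: "exponentially_bounded v"
  shows "exponentially_bounded x"
proof -
  obtain L \<delta> T0 where L: "0 < L" "0 < \<delta>" "0 \<le> T0" and bound: "\<And>t. T0 \<le> t \<Longrightarrow> norm (v t) \<le> L * exp (\<delta> * t)"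
    by (rule exponentially_boundedE[OF v]) blast
  have "norm (x T) \<le> (norm (x T0) + L) * exp ((\<delta> + 1) * T)" if T: "T0 \<le> T" for T
  proof -
    have "norm (v s) \<le> L * exp (\<delta> * T)" if "T0 < s" "s < T" for s
    proof -
      have "norm (v s) \<le> L * exp (\<delta> * s)" using that by (intro bound) auto
      also have "\<dots> \<le> L * exp (\<delta> * T)" using L that by auto
      finally show ?thesis .
    qed
    then have "norm (x T - x T0) \<le> L * exp (\<delta> * T) * (T - T0)"
      using T L by (intro increment_bound[where v = v] continuous_on_subset[OF cont] deriv) auto
    also have "\<dots> \<le> L * exp (\<delta> * T) * exp T"
      using L exp_ge_add_one_self[of T] by (intro mult_left_mono) (linarith, simp)
    also have "\<dots> = L * exp ((\<delta> + 1) * T)"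
      by (simp add: exp_add[symmetric] algebra_simps)
    finally have "norm (x T - x T0) \<le> L * exp ((\<delta> + 1) * T)" .
    moreover have "norm (x T) \<le> norm (x T0) + norm (x T - x T0)"
      using norm_triangle_ineq[of "x T0" "x T - x T0"] by simp
    moreover have "norm (x T0) \<le> norm (x T0) * exp ((\<delta> + 1) * T)"
      using L T by (simp add: mult_le_cancel_left1)
    ultimately show ?thesis by (simp add: algebra_simps)
  qed
  then show ?thesis
    using L by (intro exponentially_boundedI[of "norm (x T0) + L" "\<delta> + 1" T0]) (auto intro: add_nonneg_pos)
qed

lemma exponentially_bounded_add:
  assumes "exponentially_bounded f" "exponentially_bounded g"
  shows "exponentially_bounded (\<lambda>t. f t + g t)"
proof -
  obtain L \<delta> T where f: "0 < L" "0 < \<delta>" "0 \<le> T" "\<And>t. T \<le> t \<Longrightarrow> norm (f t) \<le> L * exp (\<delta> * t)"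
    by (rule exponentially_boundedE[OF assms(1)]) blast
  obtain L' \<delta>' T' where g: "0 < L'" "0 < \<delta>'" "0 \<le> T'" "\<And>t. T' \<le> t \<Longrightarrow> norm (g t) \<le> L' * exp (\<delta>' * t)"
    by (rule exponentially_boundedE[OF assms(2)]) blast
  have "norm (f t + g t) \<le> (L + L') * exp ((\<delta> + \<delta>') * t)" if "max T T' \<le> t" for t
  proof -
    have t: "0 \<le> t" "T \<le> t" "T' \<le> t" using that f g by auto
    have "norm (f t + g t) \<le> norm (f t) + norm (g t)" by (rule norm_triangle_ineq)
    also have "\<dots> \<le> L * exp (\<delta> * t) + L' * exp (\<delta>' * t)" using t by (intro add_mono f g)
    also have "\<dots> \<le> L * exp ((\<delta> + \<delta>') * t) + L' * exp ((\<delta> + \<delta>') * t)"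
      using f g t by (intro add_mono mult_left_mono) (auto intro!: mult_right_mono)
    finally show ?thesis by (simp add: algebra_simps)
  qed
  then show ?thesis
    using f g by (intro exponentially_boundedI[of "L + L'" "\<delta> + \<delta>'" "max T T'"]) auto
qed

lemma exponentially_bounded_blinfun:
  assumes "exponentially_bounded f"
  shows "exponentially_bounded (\<lambda>t. blinfun_apply A (f t))"
proof -
  obtain L \<delta> T where f: "0 < L" "0 < \<delta>" "0 \<le> T" "\<And>t. T \<le> t \<Longrightarrow> norm (f t) \<le> L * exp (\<delta> * t)"
    by (rule exponentially_boundedE[OF assms(1)]) blast
  have "norm (blinfun_apply A (f t)) \<le> ((norm A + 1) * L) * exp (\<delta> * t)" if "T \<le> t" for t
  proof -
    have "norm (blinfun_apply A (f t)) \<le> norm A * norm (f t)" by (rule norm_blinfun)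
    also have "\<dots> \<le> (norm A + 1) * (L * exp (\<delta> * t))"
      using f(4)[OF that] by (intro mult_mono) auto
    finally show ?thesis by simp
  qed
  then show ?thesis
    using f by (intro exponentially_boundedI[of "(norm A + 1) * L" \<delta> T])
      (auto intro!: mult_pos_pos add_nonneg_pos)
qed

lemma exponentially_bounded_cong:
  assumes "exponentially_bounded f" "\<And>t. 0 < t \<Longrightarrow> g t = f t"
  shows "exponentially_bounded g"
proof -
  obtain L \<delta> T where f: "0 < L" "0 < \<delta>" "0 \<le> T" "\<And>t. T \<le> t \<Longrightarrow> norm (f t) \<le> L * exp (\<delta> * t)"
    by (rule exponentially_boundedE[OF assms(1)]) blast
  then show ?thesis
    using assms(2) by (intro exponentially_boundedI[of L \<delta> "T + 1"]) auto
qed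

section \<open>Existence of Laplace transforms\<close>

text \<open>
  Multiplication of \<open>f t\<close> by a complex number multiplies the norm in the complexification by its modulus, so
  the integrand is dominated by \<open>norm (f t)\<close> up to time \<open>T\<close> and by a decaying exponential afterwards.
\<close>

lemma laplace_transform_exists_continuous:
  fixes f :: "real \<Rightarrow> 'a::banach"
  assumes cont: "continuous_on {0<..} f"
    and fin: "\<And>T. (\<integral>\<^sup>+t. ennreal (indicator {0<..<T} t * norm (f t)) \<partial>lborel) < \<infinity>"
    and exp: "exponentially_bounded f"
  shows "laplace_transform_exists f"
proof -
  obtain L \<delta> T where L: "0 < L" "0 < \<delta>" "0 \<le> T" and bound: "\<And>t. T \<le> t \<Longrightarrow> norm (f t) \<le> L * exp (\<delta> * t)"
    by (rule exponentially_boundedE[OF exp]) blast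
  have "\<exists>F. has_laplace_transform f z F" if z: "\<delta> < Re z" for z
  proof -
    let ?e = "\<lambda>t. exp (- z * complex_of_real t)"
    let ?F = "\<lambda>t. (Re (?e t) *\<^sub>R f t, Im (?e t) *\<^sub>R f t)"
    have norm_F: "norm (?F t) = exp (- Re z * t) * norm (f t)" for t
    proof -
      have "norm (?F t) = sqrt ((Re (?e t))\<^sup>2 + (Im (?e t))\<^sup>2) * norm (f t)"
        by (simp add: norm_Pair power_mult_distrib distrib_right[symmetric] real_sqrt_mult)
      also have "sqrt ((Re (?e t))\<^sup>2 + (Im (?e t))\<^sup>2) = exp (- Re z * t)"
        unfolding cmod_def[symmetric] by simp
      finally show ?thesis .
    qed
    have "(\<integral>\<^sup>+t. norm (?F t) \<partial>lebesgue_on {0..}) = (\<integral>\<^sup>+t. ennreal (norm (?F t)) * indicator {0..} t \<partial>lborel)"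
      by (simp add: nn_integral_restrict_space nn_integral_completion)
    also have "\<dots> \<le> (\<integral>\<^sup>+t. ennreal (indicator {0<..<T} t * norm (f t))
        + ennreal L * ennreal (indicator {0..} t * exp (- (Re z - \<delta>) * t)) \<partial>lborel)"
    proof (rule nn_integral_mono_AE)
      show "AE t in lborel. ennreal (norm (?F t)) * indicator {0..} t \<le> ennreal (indicator {0<..<T} t * norm (f t))
        + ennreal L * ennreal (indicator {0..} t * exp (- (Re z - \<delta>) * t))"
        using AE_lborel_singleton[of 0]
      proof eventually_elim
        case (elim t)
        have "norm (?F t) * indicator {0..} t \<le> indicator {0<..<T} t * norm (f t)
          + L * (indicator {0..} t * exp (- (Re z - \<delta>) * t))"
        proof (cases "0 < t")
          case False
          then show ?thesis using elim L by (auto split: split_indicator)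
        next
          case t: True
          show ?thesis
          proof (cases "t < T")
            case True
            have "exp (- Re z * t) * norm (f t) \<le> 1 * norm (f t)"
              using t z L by (intro mult_right_mono) auto
            moreover have "0 \<le> L * exp (- (Re z - \<delta>) * t)" using L by simp
            ultimately show ?thesis unfolding norm_F using t True by simp
          next
            case False
            have "exp (- Re z * t) * norm (f t) \<le> exp (- Re z * t) * (L * exp (\<delta> * t))"
              using False by (intro mult_left_mono bound) auto
            also have "\<dots> = L * exp (- (Re z - \<delta>) * t)"
              by (simp add: exp_add[symmetric] algebra_simps)
            finally show ?thesis unfolding norm_F using t False by simp
          qed
        qed
        then have "ennreal (norm (?F t) * indicator {0..} t) \<le> ennreal (indicator {0<..<T} t * norm (f t)
          + L * (indicator {0..} t * exp (- (Re z - \<delta>) * t)))" by (rule ennreal_leI)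
        moreover have "ennreal (norm (?F t) * indicator {0..} t) = ennreal (norm (?F t)) * indicator {0..} t"
          by (auto split: split_indicator)
        moreover have "ennreal (indicator {0<..<T} t * norm (f t) + L * (indicator {0..} t * exp (- (Re z - \<delta>) * t)))
          = ennreal (indicator {0<..<T} t * norm (f t)) + ennreal L * ennreal (indicator {0..} t * exp (- (Re z - \<delta>) * t))"
          using L by (subst ennreal_plus) (auto simp: ennreal_mult')
        ultimately show ?case by simp
      qed
    qed
    also have "\<dots> = (\<integral>\<^sup>+t. ennreal (indicator {0<..<T} t * norm (f t)) \<partial>lborel)
        + ennreal L * ennreal (exp (- (Re z - \<delta>) * 0) / (Re z - \<delta>))"
    proof -
      have [measurable]: "(\<lambda>t. indicator {0<..<T} t * norm (f t)) \<in> borel_measurable borel"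
        by (intro borel_measurable_indicator_norm continuous_on_subset[OF cont]) auto
      have "(\<integral>\<^sup>+t. ennreal (indicator {0..} t * exp (- (Re z - \<delta>) * t)) \<partial>lborel)
        = ennreal (exp (- (Re z - \<delta>) * 0) / (Re z - \<delta>))"
        using z by (intro nn_integral_has_integral_lebesgue has_integral_exp_minus_to_infinity) auto
      then show ?thesis
        by (subst nn_integral_add, measurable) (simp add: nn_integral_cmult)
    qed
    also have "\<dots> < \<infinity>" using fin[of T] by (simp add: ennreal_mult_less_top)
    finally have fin': "(\<integral>\<^sup>+t. norm (?F t) \<partial>lebesgue_on {0..}) < \<infinity>" .
    have "continuous_on {0<..} ?F"
      by (intro continuous_intros cont)
    from has_strong_bochner_integral_continuous[OF this fin'] show ?thesis
      unfolding has_laplace_transform_def .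
  qed
  then show ?thesis unfolding laplace_transform_exists_def by blast
qed

section \<open>Caputo derivatives\<close>

declare nth_deriv.simps [simp del]

lemma has_caputo_derivative_unique:
  assumes "has_caputo_derivative \<nu> x t D" "has_caputo_derivative \<nu> x t D'"
  shows "D = D'"
  using assms has_strong_bochner_integral_unique[of "{0..t}"]
  by (auto simp: has_caputo_derivative_def Let_def split: if_splits)

lemma has_caputo_derivative_caputo_derivative:
  assumes "caputo_differentiable \<nu> x t"
  shows "has_caputo_derivative \<nu> x t (caputo_derivative \<nu> x t)"
proof -
  obtain D where D: "has_caputo_derivative \<nu> x t D"
    using assms by (auto simp: caputo_differentiable_def)
  show ?thesis
    unfolding caputo_derivative_def
    by (rule theI[of _ D]) (use D has_caputo_derivative_unique in blast)+
qed

lemma nth_deriv_has_vector_derivative: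
  assumes "nth_deriv k x differentiable (at t within {0..})" "0 < t"
  shows "(nth_deriv k x has_vector_derivative nth_deriv (Suc k) x t) (at t)"
proof -
  have "at t within {0..} = at t"
    using assms(2) by (intro at_within_interior) (simp add: interior_real_atLeast)
  then show ?thesis
    unfolding nth_deriv.simps(2) using assms(1) vector_derivative_works by metis
qed

lemma caputo_differentiable_derivatives:
  assumes "1 < \<alpha>" "\<alpha> \<le> 2" "0 < t" "caputo_differentiable \<alpha> x t"
  shows "(x has_vector_derivative nth_deriv 1 x t) (at t)"
    and "(nth_deriv 1 x has_vector_derivative nth_deriv 2 x t) (at t)"
proof -
  have "\<lceil>\<alpha>\<rceil> = 2" using assms by (intro ceiling_unique) auto
  then have n: "nat \<lceil>\<alpha>\<rceil> = 2" by simp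
  have "\<forall>k<2. nth_deriv k x differentiable (at t within {0..})"
    using has_caputo_derivative_caputo_derivative[OF assms(4)] assms(3) n
    by (auto simp: has_caputo_derivative_def Let_def)
  then show "(x has_vector_derivative nth_deriv 1 x t) (at t)"
    and "(nth_deriv 1 x has_vector_derivative nth_deriv 2 x t) (at t)"
    using nth_deriv_has_vector_derivative[of 0 x t] nth_deriv_has_vector_derivative[of 1 x t] assms(3)
    by (auto simp: numeral_2_eq_2 nth_deriv.simps(1))
qed

lemma caputo_derivative_one: "caputo_differentiable 1 x t \<Longrightarrow> caputo_derivative 1 x t = nth_deriv 1 x t"
  using has_caputo_derivative_caputo_derivative[of 1 x t]
  by (simp add: has_caputo_derivative_def)

lemma caputo_derivative_two: "caputo_differentiable 2 x t \<Longrightarrow> caputo_derivative 2 x t = nth_deriv 2 x t"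
  using has_caputo_derivative_caputo_derivative[of 2 x t]
  by (simp add: has_caputo_derivative_def)

lemma caputo_derivative_order_less_1:
  assumes "0 < \<beta>" "\<beta> < 1" "caputo_differentiable \<beta> x t" "v = nth_deriv 1 x"
  obtains J where "has_strong_bochner_integral (lebesgue_on {0..t}) (\<lambda>s. (t - s) powr (- \<beta>) *\<^sub>R v s) J"
    "caputo_derivative \<beta> x t = (1 / Gamma (1 - \<beta>)) *\<^sub>R J"
proof -
  have "\<lceil>\<beta>\<rceil> = 1" using assms by (intro ceiling_unique) auto
  then have n: "nat \<lceil>\<beta>\<rceil> = 1" by simp
  show ?thesis
    using has_caputo_derivative_caputo_derivative[OF assms(3)] assms(2,4) that
    by (auto simp: has_caputo_derivative_def n)
qed

text \<open>
  On \<open>(0,T)\<close> the kernel \<open>(T - s) powr (- \<beta>)\<close> is at least \<open>T powr (- \<beta>)\<close>; existence of the Caputo derivative at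
  the single time \<open>T\<close> therefore makes \<open>x'\<close> integrable on \<open>(0,T)\<close>.
\<close>

lemma weak_fractional_integral_caputo:
  fixes x v :: "real \<Rightarrow> 'a::real_normed_vector"
  assumes \<beta>: "0 < \<beta>" "\<beta> < 1" and cont: "continuous_on {0<..} v" and v: "v = nth_deriv 1 x"
    and diff: "\<And>t. 0 < t \<Longrightarrow> caputo_differentiable \<beta> x t"
  shows "weak_fractional_integral v (caputo_derivative \<beta> x) (1 - \<beta>) (1 / Gamma (1 - \<beta>))"
proof
  show "0 < 1 - \<beta>" "1 - \<beta> < 1" "0 < 1 / Gamma (1 - \<beta>)"
    using \<beta> by (auto intro: Gamma_real_pos)
  have meas_norm: "(\<lambda>s. indicator {0<..} s * norm (v s)) \<in> borel_measurable borel"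
    by (intro borel_measurable_indicator_norm cont) simp
  show "(\<integral>\<^sup>+s. ennreal (indicator {0<..<T} s * norm (v s)) \<partial>lborel) < \<infinity>" for T
  proof (cases "0 < T")
    case True
    obtain J where J: "has_strong_bochner_integral (lebesgue_on {0..T}) (\<lambda>s. (T - s) powr (- \<beta>) *\<^sub>R v s) J"
      using caputo_derivative_order_less_1[OF \<beta> diff[OF True] v] by metis
    let ?g = "\<lambda>s. indicator {..<T} s * ((T - s) powr (- \<beta>) * (indicator {0<..} s * norm (v s)))"
    have [measurable]: "?g \<in> borel_measurable borel"
      using meas_norm by measurable
    have "(\<integral>\<^sup>+s. ennreal (indicator {0<..<T} s * norm (v s)) \<partial>lborel)
      \<le> (\<integral>\<^sup>+s. ennreal (T powr \<beta>) * ennreal (?g s) \<partial>lborel)"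
    proof (rule nn_integral_mono)
      fix s
      have "norm (v s) \<le> T powr \<beta> * ((T - s) powr (- \<beta>) * norm (v s))" if s: "0 < s" "s < T"
      proof -
        have "1 = T powr \<beta> * T powr (- \<beta>)" using True by (simp add: powr_add[symmetric])
        also have "\<dots> \<le> T powr \<beta> * (T - s) powr (- \<beta>)"
          using s \<beta> by (intro mult_left_mono powr_mono2') auto
        finally have "1 * norm (v s) \<le> T powr \<beta> * (T - s) powr (- \<beta>) * norm (v s)"
          by (intro mult_right_mono) auto
        then show ?thesis by (simp add: mult.assoc)
      qed
      then have "indicator {0<..<T} s * norm (v s) \<le> T powr \<beta> * ?g s"
        by (auto split: split_indicator)
      then show "ennreal (indicator {0<..<T} s * norm (v s)) \<le> ennreal (T powr \<beta>) * ennreal (?g s)"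
        by (subst ennreal_mult'[symmetric]) (auto intro: ennreal_leI)
    qed
    also have "\<dots> = ennreal (T powr \<beta>) * (\<integral>\<^sup>+s. ennreal (?g s) \<partial>lborel)"
      by (intro nn_integral_cmult) simp
    also have "\<dots> \<le> ennreal (T powr \<beta>) * (\<integral>\<^sup>+s. norm ((T - s) powr (- \<beta>) *\<^sub>R v s) \<partial>lebesgue_on {0..T})"
    proof (rule mult_left_mono)
      have "(\<integral>\<^sup>+s. ennreal (?g s) \<partial>lborel) \<le> (\<integral>\<^sup>+s. ennreal (norm ((T - s) powr (- \<beta>) *\<^sub>R v s)) * indicator {0..T} s \<partial>lborel)"
        by (intro nn_integral_mono) (auto split: split_indicator)
      then show "(\<integral>\<^sup>+s. ennreal (?g s) \<partial>lborel) \<le> (\<integral>\<^sup>+s. norm ((T - s) powr (- \<beta>) *\<^sub>R v s) \<partial>lebesgue_on {0..T})"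
        by (simp add: nn_integral_restrict_space nn_integral_completion)
    qed simp
    also have "\<dots> < \<infinity>"
      using has_strong_bochner_integral_nn_finite[OF _ J] by (simp add: ennreal_mult_less_top)
    finally show ?thesis .
  qed simp
  fix \<phi> :: "'a \<Rightarrow> real" and t :: real
  assume \<phi>: "bounded_linear \<phi>" "\<And>y. \<bar>\<phi> y\<bar> \<le> norm y" and t: "0 < t"
  interpret \<phi>: bounded_linear \<phi> by fact
  obtain J where J: "has_strong_bochner_integral (lebesgue_on {0..t}) (\<lambda>s. (t - s) powr (- \<beta>) *\<^sub>R v s) J"
    "caputo_derivative \<beta> x t = (1 / Gamma (1 - \<beta>)) *\<^sub>R J"
    by (rule caputo_derivative_order_less_1[OF \<beta> diff[OF t] v])
  let ?f = "\<lambda>s. indicator {0..t} s *\<^sub>R \<phi> ((t - s) powr (- \<beta>) *\<^sub>R v s)"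
  let ?k = "\<lambda>s. power_kernel (1 - \<beta>) (t - s) * (indicator {0<..} s * \<phi> (v s))"
  have "has_bochner_integral (lebesgue_on {0..t}) (\<lambda>s. \<phi> ((t - s) powr (- \<beta>) *\<^sub>R v s)) (\<phi> J)"
    using J(1) \<phi> by (intro has_strong_bochner_integral_functional) auto
  then have f: "has_bochner_integral lebesgue ?f (\<phi> J)"
    by (subst (asm) has_bochner_integral_restrict_space) auto
  have k: "?k \<in> borel_measurable borel"
  proof -
    have "(\<lambda>s. indicator {0<..} s * \<phi> (v s)) \<in> borel_measurable borel"
      by (intro borel_measurable_indicator_functional cont \<phi>(1)) simp
    then show ?thesis by measurable
  qed
  have ae: "AE s in lebesgue. ?f s = ?k s"
  proof -
    have "AE s in lebesgue. s \<noteq> 0"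
      using AE_completion[OF AE_lborel_singleton[of 0]] .
    then show ?thesis
      by eventually_elim (auto simp: \<phi>.scaleR power_kernel_def split: split_indicator)
  qed
  have "has_bochner_integral lebesgue ?k (\<phi> J)"
    using f ae k by (subst has_bochner_integral_cong_AE[symmetric, where f = ?f])
      (auto dest: borel_measurable_has_bochner_integral intro: measurable_completion)
  then have "has_bochner_integral lborel ?k (\<phi> J)"
    using k by (simp add: has_bochner_integral_iff integrable_completion integral_completion)
  then have "has_bochner_integral lborel (\<lambda>s. 1 / Gamma (1 - \<beta>) * ?k s) (1 / Gamma (1 - \<beta>) * \<phi> J)"
    by (rule has_bochner_integral_mult_right)
  then show "has_bochner_integral lborel (\<lambda>s. 1 / Gamma (1 - \<beta>) * ?k s) (\<phi> (caputo_derivative \<beta> x t))"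
    by (simp add: J(2) \<phi>.scaleR)
qed (rule cont)

lemma bounded_imp_locally_integrable:
  fixes f :: "real \<Rightarrow> 'a::real_normed_vector"
  assumes "\<And>t. 0 < t \<Longrightarrow> t < T \<Longrightarrow> norm (f t) \<le> K"
  shows "(\<integral>\<^sup>+t. ennreal (indicator {0<..<T} t * norm (f t)) \<partial>lborel) < \<infinity>"
proof -
  have "(\<integral>\<^sup>+t. ennreal (indicator {0<..<T} t * norm (f t)) \<partial>lborel) \<le> (\<integral>\<^sup>+t. ennreal K * indicator {0<..<T} t \<partial>lborel)"
    using assms by (intro nn_integral_mono) (auto split: split_indicator intro: ennreal_leI)
  also have "\<dots> = ennreal K * emeasure lborel {0<..<T}"
    by (rule nn_integral_cmult_indicator) simp
  also have "\<dots> < \<infinity>"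
    by (cases "0 \<le> T") (auto simp: ennreal_mult_less_top)
  finally show ?thesis .
qed

lemma continuous_bounded_Icc:
  fixes f :: "real \<Rightarrow> 'a::real_normed_vector"
  assumes "continuous_on {a..b} f"
  shows "\<exists>K\<ge>0. \<forall>t\<in>{a..b}. norm (f t) \<le> K"
proof -
  have "bounded (f ` {a..b})"
    using assms by (intro compact_imp_bounded compact_continuous_image) auto
  then obtain K where "\<forall>t\<in>{a..b}. norm (f t) \<le> K"
    by (meson bounded_iff imageI)
  then show ?thesis
    by (intro exI[of _ "max 0 K"]) (auto simp: le_max_iff_disj)
qed

text \<open>
  The kernel of the Caputo derivative at time \<open>1\<close> is at least \<open>1\<close> on \<open>(0,1)\<close>, so \<open>x''\<close> is integrable near \<open>0\<close>
  and the fundamental theorem of calculus bounds \<open>x'\<close>. The upper limit \<open>1/2\<close> keeps away from the endpoint \<open>1\<close>,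
  where the formal value of the kernel is \<open>0 powr (1 - \<alpha>) = 0\<close>.
\<close>

lemma bounded_near_0_if_caputo:
  fixes x :: "real \<Rightarrow> 'a::banach"
  assumes \<alpha>: "1 < \<alpha>" "\<alpha> < 2" and diff: "\<And>t. 0 < t \<Longrightarrow> caputo_differentiable \<alpha> x t"
  obtains K where "\<And>t. 0 < t \<Longrightarrow> t \<le> 1/2 \<Longrightarrow> norm (nth_deriv 1 x t) \<le> K"
proof -
  let ?v = "nth_deriv 1 x" and ?w = "nth_deriv 2 x"
  let ?F = "\<lambda>s. (1 - s) powr (1 - \<alpha>) *\<^sub>R ?w s"
  have "\<lceil>\<alpha>\<rceil> = 2" using \<alpha> by (intro ceiling_unique) auto
  then have n: "nat \<lceil>\<alpha>\<rceil> = 2" by simp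
  obtain J where J: "has_strong_bochner_integral (lebesgue_on {0..1}) ?F J"
    using has_caputo_derivative_caputo_derivative[OF diff[of 1]] \<alpha>
    by (auto simp: has_caputo_derivative_def n)
  have "(\<lambda>s. norm (?F s)) \<in> borel_measurable (lebesgue_on {0..1})"
    using J by (intro strongly_measurable_continuous_real) (auto simp: has_strong_bochner_integral_def intro: continuous_intros)
  then have "integrable (lebesgue_on {0..1}) (\<lambda>s. norm (?F s))"
    using has_strong_bochner_integral_nn_finite[OF _ J] by (intro integrableI_nonneg) auto
  then have "(\<lambda>s. norm (?F s)) absolutely_integrable_on {0..1}"
    by (simp add: set_integrable_def integrable_restrict_space)
  then have F: "(\<lambda>s. norm (?F s)) integrable_on {0..1}"
    by (rule set_lebesgue_integral_eq_integral)
  have deriv: "(?v has_vector_derivative ?w t) (at t)" if "0 < t" for t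
    using caputo_differentiable_derivatives(2)[OF \<alpha>(1) _ that diff[OF that]] \<alpha> by simp
  have "norm (?v t) \<le> norm (?v (1/2)) + integral {0..1} (\<lambda>s. norm (?F s))" if t: "0 < t" "t \<le> 1/2" for t
  proof -
    have w: "(?w has_integral (?v (1/2) - ?v t)) {t..1/2}"
      using t by (intro fundamental_theorem_of_calculus) (auto intro!: has_vector_derivative_at_within deriv simp del: One_nat_def)
    have Ft: "(\<lambda>s. norm (?F s)) integrable_on {t..1/2}"
      using F by (rule integrable_on_subinterval) (use t in auto)
    have "norm (?v (1/2) - ?v t) = norm (integral {t..1/2} ?w)"
      using w by (simp add: integral_unique)
    also have "\<dots> \<le> integral {t..1/2} (\<lambda>s. norm (?F s))"
    proof (rule integral_norm_bound_integral[OF has_integral_integrable[OF w] Ft])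
      fix s assume s: "s \<in> {t..1/2}"
      have "1 powr (1 - \<alpha>) \<le> (1 - s) powr (1 - \<alpha>)"
        using s t \<alpha> by (intro powr_mono2') auto
      then have "1 * norm (?w s) \<le> (1 - s) powr (1 - \<alpha>) * norm (?w s)"
        by (intro mult_right_mono) auto
      then show "norm (?w s) \<le> norm (?F s)" by simp
    qed
    also have "\<dots> \<le> integral {0..1} (\<lambda>s. norm (?F s))"
      using F Ft t by (intro integral_subset_le) auto
    finally show ?thesis
      using norm_triangle_ineq2[of "?v t" "?v (1/2)"] by (simp add: norm_minus_commute)
  qed
  then show ?thesis by (rule that)
qed

text \<open>
  The unknown term \<open>A v\<close> is the derivative of \<open>A x\<close>. Hence \<open>v - A x\<close> has the bounded derivative \<open>r\<close>, and \<open>x\<close>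
  itself is bounded near \<open>0\<close>.
\<close>

lemma bounded_near_0_if_second_order:
  fixes x v :: "real \<Rightarrow> 'a::banach"
  assumes cont: "continuous_on {0..} x" "continuous_on {0..} r"
    and x: "\<And>t. 0 < t \<Longrightarrow> (x has_vector_derivative v t) (at t)"
    and v: "\<And>t. 0 < t \<Longrightarrow> (v has_vector_derivative (blinfun_apply A (v t) + r t)) (at t)"
  obtains K where "\<And>t. 0 < t \<Longrightarrow> t \<le> 1 \<Longrightarrow> norm (v t) \<le> K"
proof -
  let ?u = "\<lambda>t. v t - blinfun_apply A (x t)"
  have u: "(?u has_vector_derivative r t) (at t)" if "0 < t" for t
  proof -
    have "((\<lambda>t. blinfun_apply A (x t)) has_vector_derivative blinfun_apply A (v t)) (at t)"
      by (rule bounded_linear.has_vector_derivative[OF blinfun.bounded_linear_right x[OF that]])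
    from has_vector_derivative_diff[OF v[OF that] this] show ?thesis by simp
  qed
  obtain R where R: "0 \<le> R" "\<And>t. 0 \<le> t \<Longrightarrow> t \<le> 1 \<Longrightarrow> norm (r t) \<le> R"
    using continuous_bounded_Icc[OF continuous_on_subset[OF cont(2), of "{0..1}"]] by fastforce
  obtain M where M: "0 \<le> M" "\<And>t. 0 \<le> t \<Longrightarrow> t \<le> 1 \<Longrightarrow> norm (x t) \<le> M"
    using continuous_bounded_Icc[OF continuous_on_subset[OF cont(1), of "{0..1}"]] by fastforce
  have "norm (v t) \<le> norm A * M + (norm (?u 1) + R)" if t: "0 < t" "t \<le> 1" for t
  proof -
    have "continuous_on {t..1} ?u"
      by (intro continuous_at_imp_continuous_on ballI has_vector_derivative_continuous[OF u]) (use t in auto)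
    then have "norm (?u 1 - ?u t) \<le> R * (1 - t)"
      using t R u by (intro increment_bound[where v = r]) auto
    also have "\<dots> \<le> R" using R t by (simp add: mult_left_le)
    finally have "norm (?u t) \<le> norm (?u 1) + R"
      using norm_triangle_ineq2[of "?u t" "?u 1"] by (simp add: norm_minus_commute)
    moreover have "norm (blinfun_apply A (x t)) \<le> norm A * M"
      using norm_blinfun[of A "x t"] M(2)[of t] t by (meson less_imp_le mult_left_mono norm_ge_zero order_trans)
    moreover have "norm (v t) \<le> norm (blinfun_apply A (x t)) + norm (?u t)"
      using norm_triangle_ineq[of "blinfun_apply A (x t)" "?u t"] by simp
    ultimately show ?thesis by linarith
  qed
  then show ?thesis by (rule that)
qed

section \<open>Growth of the solution of the Cauchy problem\<close>

theorem theorem3p1: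
  fixes A B :: "'a::banach \<Rightarrow>\<^sub>L 'a"
    and \<alpha> \<beta> :: real
    and \<eta> \<eta>' :: 'a
    and g x :: "real \<Rightarrow> 'a"
  assumes "1 < \<alpha>" "\<alpha> \<le> 2" "0 < \<beta>" "\<beta> \<le> 1"
    and "cauchy_solution \<alpha> \<beta> A B g \<eta> \<eta>' x"
    and "\<And>y. cauchy_solution \<alpha> \<beta> A B g \<eta> \<eta>' y \<Longrightarrow> (\<forall>t\<ge>0. y t = x t)"
    and "continuous_on {0..} g"
    and "exponentially_bounded g"
    and "exponentially_bounded (caputo_derivative \<beta> x)"
  shows "exponentially_bounded x \<and> exponentially_bounded (caputo_derivative \<alpha> x) \<and>
         laplace_transform_exists x \<and> laplace_transform_exists (caputo_derivative \<alpha> x)"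
proof -
  let ?h = "caputo_derivative \<beta> x" and ?f = "caputo_derivative \<alpha> x"
  define v where "v = nth_deriv 1 x"
  have cont_x: "continuous_on {0..} x"
    and diff: "\<And>t. 0 < t \<Longrightarrow> caputo_differentiable \<alpha> x t" "\<And>t. 0 < t \<Longrightarrow> caputo_differentiable \<beta> x t"
    and eq: "\<And>t. 0 < t \<Longrightarrow> ?f t = blinfun_apply A (?h t) + (blinfun_apply B (x t) + g t)"
    using assms(5) unfolding cauchy_solution_def by (auto simp: diff_eq_eq add.commute)
  have x': "(x has_vector_derivative v t) (at t)"
    and v': "(v has_vector_derivative nth_deriv 2 x t) (at t)" if "0 < t" for t
    using caputo_differentiable_derivatives[OF assms(1,2) that diff(1)[OF that]] by (simp_all add: v_def)
  have cont_v: "continuous_on {0<..} v"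
    by (intro continuous_at_imp_continuous_on ballI has_vector_derivative_continuous[OF v']) auto
  have cont_r: "continuous_on {0..} (\<lambda>t. blinfun_apply B (x t) + g t)"
    by (intro continuous_intros cont_x assms(7))

  have h: "exponentially_bounded x \<and> continuous_on {0<..} ?h
    \<and> (\<forall>T. (\<integral>\<^sup>+t. ennreal (indicator {0<..<T} t * norm (?h t)) \<partial>lborel) < \<infinity>)"
  proof (cases "\<beta> = 1")
    case False
    interpret weak_fractional_integral v ?h "1 - \<beta>" "1 / Gamma (1 - \<beta>)"
      using assms(3,4) False diff(2) cont_v v_def
      by (intro weak_fractional_integral_caputo) auto
    have "exponentially_bounded x"
      by (intro exponentially_bounded_primitive[OF cont_x] x' assms(9))
    then show ?thesis using continuous_h finite_h by blast
  next
    case True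
    have hv: "?h t = v t" if "0 < t" for t
      using caputo_derivative_one[of x t] diff(2)[OF that] True by (simp add: v_def)
    have "exponentially_bounded v"
      using assms(9) by (rule exponentially_bounded_cong) (simp add: hv)
    then have ex: "exponentially_bounded x"
      by (intro exponentially_bounded_antiderivative[OF cont_x, of v] x')
    have ch: "continuous_on {0<..} ?h"
      using cont_v by (rule continuous_on_cong[THEN iffD1, rotated 2]) (auto simp: hv)
    obtain K where K: "\<And>t. 0 < t \<Longrightarrow> t \<le> 1/2 \<Longrightarrow> norm (v t) \<le> K"
    proof (cases "\<alpha> = 2")
      case False
      then show ?thesis
        using bounded_near_0_if_caputo[of \<alpha> x] assms(1,2) diff(1) that unfolding v_def by (metis less_eq_real_def)
    next
      case \<alpha>: True
      have "(v has_vector_derivative (blinfun_apply A (v t) + (blinfun_apply B (x t) + g t))) (at t)" if "0 < t" for t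
        using v'[OF that] eq[OF that] hv[OF that] caputo_derivative_two[of x t] diff(1)[OF that] \<alpha> by simp
      then obtain K where "\<And>t. 0 < t \<Longrightarrow> t \<le> 1 \<Longrightarrow> norm (v t) \<le> K"
        using bounded_near_0_if_second_order[OF cont_x cont_r, of v A] x' by blast
      then show ?thesis by (intro that[of K]) auto
    qed
    have "(\<integral>\<^sup>+t. ennreal (indicator {0<..<T} t * norm (?h t)) \<partial>lborel) < \<infinity>" for T
    proof -
      obtain M where M: "\<And>t. 1/2 \<le> t \<Longrightarrow> t \<le> T \<Longrightarrow> norm (v t) \<le> M"
        using continuous_bounded_Icc[OF continuous_on_subset[OF cont_v, of "{1/2..T}"]] by fastforce
      have "norm (?h t) \<le> max K M" if "0 < t" "t < T" for t
        using K[of t] M[of t] that hv[of t] by (cases "t \<le> 1/2") auto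
      then show ?thesis by (rule bounded_imp_locally_integrable)
    qed
    with ex ch show ?thesis by blast
  qed
  then have ex: "exponentially_bounded x" and ch: "continuous_on {0<..} ?h"
    and fh: "\<And>T. (\<integral>\<^sup>+t. ennreal (indicator {0<..<T} t * norm (?h t)) \<partial>lborel) < \<infinity>"
    by auto
  have ef: "exponentially_bounded ?f"
  proof (rule exponentially_bounded_cong)
    show "exponentially_bounded (\<lambda>t. blinfun_apply A (?h t) + (blinfun_apply B (x t) + g t))"
      by (intro exponentially_bounded_add exponentially_bounded_blinfun ex assms(8,9))
  qed (rule eq)
  have bounded: "\<exists>K\<ge>0. \<forall>t. 0 < t \<longrightarrow> t < T \<longrightarrow> norm (y t) \<le> K"
    if "continuous_on {0..} y" for y :: "real \<Rightarrow> 'a" and T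
    using continuous_bounded_Icc[OF continuous_on_subset[OF that, of "{0..T}"]] by fastforce
  have lx: "laplace_transform_exists x"
  proof (rule laplace_transform_exists_continuous[OF _ _ ex])
    show "continuous_on {0<..} x" using cont_x by (rule continuous_on_subset) auto
    show "(\<integral>\<^sup>+t. ennreal (indicator {0<..<T} t * norm (x t)) \<partial>lborel) < \<infinity>" for T
      using bounded[OF cont_x, of T] bounded_imp_locally_integrable by blast
  qed
  have lf: "laplace_transform_exists ?f"
  proof (rule laplace_transform_exists_continuous[OF _ _ ef])
    have "continuous_on {0<..} (\<lambda>t. blinfun_apply A (?h t) + (blinfun_apply B (x t) + g t))"
      by (intro continuous_intros ch continuous_on_subset[OF cont_x] continuous_on_subset[OF assms(7)]) auto
    then show "continuous_on {0<..} ?f"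
      by (rule continuous_on_cong[THEN iffD1, rotated 2]) (auto simp: eq)
    fix T
    obtain K where K: "0 \<le> K" "\<And>t. 0 < t \<Longrightarrow> t < T \<Longrightarrow> norm (blinfun_apply B (x t) + g t) \<le> K"
      using bounded[OF cont_r, of T] by blast
    have [measurable]: "(\<lambda>t. indicator {0<..<T} t * norm (?h t)) \<in> borel_measurable borel"
      by (intro borel_measurable_indicator_norm continuous_on_subset[OF ch]) auto
    have "(\<integral>\<^sup>+t. ennreal (indicator {0<..<T} t * norm (?f t)) \<partial>lborel)
      \<le> (\<integral>\<^sup>+t. ennreal (norm A) * ennreal (indicator {0<..<T} t * norm (?h t)) + ennreal K * indicator {0<..<T} t \<partial>lborel)"
    proof (rule nn_integral_mono)
      fix t
      have "norm (?f t) \<le> norm A * norm (?h t) + K" if "0 < t" "t < T"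
        using norm_triangle_ineq[of "blinfun_apply A (?h t)" "blinfun_apply B (x t) + g t"]
          norm_blinfun[of A "?h t"] K(2)[OF that] eq[OF that(1)] by simp
      then have "ennreal (indicator {0<..<T} t * norm (?f t))
        \<le> ennreal (norm A * (indicator {0<..<T} t * norm (?h t)) + K * indicator {0<..<T} t)"
        by (intro ennreal_leI) (auto split: split_indicator)
      also have "\<dots> = ennreal (norm A) * ennreal (indicator {0<..<T} t * norm (?h t)) + ennreal K * indicator {0<..<T} t"
        using K(1) by (subst ennreal_plus) (auto simp: ennreal_mult' split: split_indicator)
      finally show "ennreal (indicator {0<..<T} t * norm (?f t))
        \<le> ennreal (norm A) * ennreal (indicator {0<..<T} t * norm (?h t)) + ennreal K * indicator {0<..<T} t" .
    qed
    also have "\<dots> = ennreal (norm A) * (\<integral>\<^sup>+t. ennreal (indicator {0<..<T} t * norm (?h t)) \<partial>lborel)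
      + ennreal K * emeasure lborel {0<..<T}"
      by (subst nn_integral_add, measurable) (simp add: nn_integral_cmult nn_integral_cmult_indicator)
    also have "\<dots> < \<infinity>"
      using fh[of T] by (cases "0 \<le> T") (auto simp: ennreal_mult_less_top)
    finally show "(\<integral>\<^sup>+t. ennreal (indicator {0<..<T} t * norm (?f t)) \<partial>lborel) < \<infinity>" .
  qed
  from ex ef lx lf show ?thesis by blast
qed

end
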